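(* Let $\gamma:(-1,1)\to S^n$ be a real-analytic curve with $\gamma(0)=(0,\dots,0,-1)$ and $\gamma'(0)=(1,0,\dots,0)$. Then there exists a unique germ at $0$ of a real-analytic function $u(x)$, $x\in\mathbb{R}^n$, with $u(0)=0$ such that, if $\Sigma\subset\mathbb{R}^{n+1}$ is the graph of $u$ and $G$ is its Gauss map, then the rank of $G$ is equal to one at every point of $\Sigma$ and $G((x^1,0),u(x^1,0))=\gamma(x^1)$.
   Context: $S^n\subset\mathbb{R}^{n+1}$ is the unit sphere. For the graph $\Sigma=\{(x,u(x))\}\subset\mathbb{R}^n\times\mathbb{R}$ of a function $u$, the Gauss map $G:\Sigma\to S^n$ sends $(x,u(x))$ to the unit normal $N(x)/|N(x)|$, where $N(x)=(\partial u/\partial x^1,\dots,\partial u/\partial x^n,-1)$. Here $(x^1,0)$ denotes the point $(x^1,0,\dots,0)\in\mathbb{R}^n$. *)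

theory Defs
  imports "HOL-Analysis.Analysis"
begin

definition multi_indices :: "('a::euclidean_space \<Rightarrow> nat) set" where
  "multi_indices = {\<alpha>. \<forall>b. b \<notin> Basis \<longrightarrow> \<alpha> b = 0}"

definition real_analytic_on ::
  "('a::euclidean_space \<Rightarrow> 'b::euclidean_space) \<Rightarrow> 'a set \<Rightarrow> bool" where
  "real_analytic_on f U \<longleftrightarrow>
     (\<forall>a\<in>U. \<forall>j\<in>Basis. \<exists>r>0. \<exists>c :: ('a \<Rightarrow> nat) \<Rightarrow> real.
        \<forall>x\<in>ball a r.
          ((\<lambda>\<alpha>. c \<alpha> * (\<Prod>b\<in>Basis. ((x - a) \<bullet> b) ^ \<alpha> b)) has_sum (f x \<bullet> j))
            multi_indices)"

definition grad :: "(real^'n \<Rightarrow> real) \<Rightarrow> real^'n \<Rightarrow> real^'n" where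
  "grad u x = (\<chi> i. frechet_derivative u (at x) (axis i 1))"

definition gauss_map :: "(real^'n \<Rightarrow> real) \<Rightarrow> (real^'n) \<times> real \<Rightarrow> (real^'n) \<times> real" where
  "gauss_map u p = (1 / norm (grad u (fst p), -1::real)) *\<^sub>R (grad u (fst p), -1)"

text \<open>Rank of the Gauss map at the graph point (x, u x): rank of the differential of
  the map x \<mapsto> G(x, u x) (the graph parametrization is a diffeomorphism onto the graph).\<close>
definition gauss_rank_eq :: "(real^'n \<Rightarrow> real) \<Rightarrow> real^'n \<Rightarrow> nat \<Rightarrow> bool" where
  "gauss_rank_eq u x k \<longleftrightarrow>
     (\<exists>D. ((\<lambda>y. gauss_map u (y, u y)) has_derivative D) (at x) \<and> dim (range D) = k)"

text \<open>u is a solution on ball 0 r for the curve \<gamma>, with x^1 the coordinate k.\<close>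
definition is_solution ::
  "(real \<Rightarrow> (real^'n) \<times> real) \<Rightarrow> 'n \<Rightarrow> (real^'n \<Rightarrow> real) \<Rightarrow> real \<Rightarrow> bool" where
  "is_solution \<gamma> k u r \<longleftrightarrow>
     r > 0 \<and> real_analytic_on u (ball 0 r) \<and> u 0 = 0 \<and>
     (\<forall>x\<in>ball 0 r. gauss_rank_eq u x 1) \<and>
     (\<forall>t. \<bar>t\<bar> < r \<and> \<bar>t\<bar> < 1 \<longrightarrow>
        gauss_map u (t *\<^sub>R axis k 1, u (t *\<^sub>R axis k 1)) = \<gamma> t)"

end

theory Submission
  imports Defs "HOL-Complex_Analysis.Complex_Analysis"
begin

text \<open>
  Write \<open>e\<close> for the first basis vector and let \<open>g\<close> be the slope curve, so that \<open>\<gamma>\<close> is the unit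
  normal \<open>(g, -1) / |(g, -1)|\<close>. The solution is the envelope of the hyperplanes with slope \<open>g(t)\<close>:
  the parameter \<open>\<tau>(x)\<close> is the small root of \<open>g'(t) \<bullet> (x - t e) = 0\<close>, and
  \<open>u(x) = g(\<tau>) \<bullet> (x - \<tau> e) + \<integral>\<^sub>0\<^sup>\<tau> g \<bullet> e\<close> has gradient \<open>g(\<tau>(x))\<close>.

  Analyticity uses one complex variable only. After division by \<open>g' \<bullet> e\<close> the equation for \<open>\<tau>\<close> reads
  \<open>t = \<phi>\<^sub>x(t)\<close> with \<open>\<phi>\<^sub>x\<close> linear in \<open>x\<close>, so by residues the second derivative of \<open>u\<close> in direction
  \<open>y\<close> is the integral of \<open>(g' \<bullet> e) \<phi>\<^sub>y\<^sup>2 / (w - \<phi>\<^sub>x)\<close> over a fixed circle, divided by \<open>2 \<pi> i\<close>. Expanding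
  \<open>1 / (w - \<phi>\<^sub>a - s \<phi>\<^sub>y)\<close> geometrically and integrating twice in \<open>s\<close> gives the power series of \<open>u\<close> at \<open>a\<close>.

  For uniqueness let \<open>V\<close> be the gradient of a solution \<open>v\<close>. Since \<open>V\<close> has rank one, \<open>V\<close> and the Legendre
  transform \<open>V \<bullet> x - v\<close> are constant on the level sets of \<open>V \<bullet> e\<close>, hence functions of the point
  \<open>\<sigma>(x) e\<close> where the level set through \<open>x\<close> meets the axis. Differentiating the Legendre transform
  shows that \<open>\<sigma>(x)\<close> solves the equation of \<open>\<tau>(x)\<close>, so \<open>V = g \<circ> \<tau>\<close>.
\<close>

section \<open>Power series in several variables\<close>

definition mpow :: "('a::euclidean_space \<Rightarrow> nat) \<Rightarrow> 'a \<Rightarrow> real" where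
  "mpow \<alpha> x = (\<Prod>b\<in>Basis. (x \<bullet> b) ^ \<alpha> b)"

definition mdeg :: "('a::euclidean_space \<Rightarrow> nat) \<Rightarrow> nat" where
  "mdeg \<alpha> = (\<Sum>b\<in>Basis. \<alpha> b)"

definition mseries :: "(('a::euclidean_space \<Rightarrow> nat) \<Rightarrow> real) \<Rightarrow> 'a \<Rightarrow> real" where
  "mseries c x = (\<Sum>\<^sub>\<infinity>\<alpha>\<in>multi_indices. c \<alpha> * mpow \<alpha> x)"

text \<open>Absolute convergence at the corner point with all coordinates \<open>R\<close>. It
  controls the series on the whole ball of radius \<open>R\<close> and passes to derived series on
  smaller balls.\<close>

definition majorized :: "(('a::euclidean_space \<Rightarrow> nat) \<Rightarrow> real) \<Rightarrow> real \<Rightarrow> bool" where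
  "majorized c R \<longleftrightarrow> (\<lambda>\<alpha>. \<bar>c \<alpha>\<bar> * R ^ mdeg \<alpha>) summable_on multi_indices"

text \<open>Coefficients of the formal partial derivative along \<open>b\<close>, indexed by the
  exponents that remain after differentiation.\<close>

definition mderiv :: "'a \<Rightarrow> (('a::euclidean_space \<Rightarrow> nat) \<Rightarrow> real) \<Rightarrow> ('a \<Rightarrow> nat) \<Rightarrow> real" where
  "mderiv b c \<alpha> = real (Suc (\<alpha> b)) * c (\<alpha>(b := Suc (\<alpha> b)))"

section \<open>Multi-indices, monomials and absolute convergence\<close>

lemma multi_indices_upd: "\<alpha> \<in> multi_indices \<Longrightarrow> b \<in> Basis \<Longrightarrow> \<alpha>(b := n) \<in> multi_indices"
  by (auto simp: multi_indices_def)

lemma mdeg_upd_Suc: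
  assumes "b \<in> Basis" shows "mdeg (\<alpha>(b := Suc (\<alpha> b))) = Suc (mdeg \<alpha>)"
proof -
  have "mdeg (\<alpha>(b := Suc (\<alpha> b))) = (\<Sum>x\<in>Basis. \<alpha> x + (if x = b then 1 else 0))"
    unfolding mdeg_def by (rule sum.cong) auto
  then show ?thesis using assms by (simp add: sum.distrib mdeg_def)
qed

lemma le_mdeg: "b \<in> Basis \<Longrightarrow> \<alpha> b \<le> mdeg \<alpha>"
  unfolding mdeg_def by (rule member_le_sum) auto

lemma abs_mpow_le:
  assumes "\<And>b. b \<in> Basis \<Longrightarrow> \<bar>x \<bullet> b\<bar> \<le> \<rho>"
  shows "\<bar>mpow \<alpha> x\<bar> \<le> \<rho> ^ mdeg \<alpha>"
proof -
  have "\<bar>mpow \<alpha> x\<bar> = (\<Prod>b\<in>Basis. \<bar>x \<bullet> b\<bar> ^ \<alpha> b)"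
    by (simp add: mpow_def abs_prod power_abs)
  also have "\<dots> \<le> (\<Prod>b\<in>Basis. \<rho> ^ \<alpha> b)"
    using assms by (intro prod_mono) (auto intro: power_mono)
  finally show ?thesis by (simp add: mdeg_def power_sum)
qed

lemma abs_mpow_le_norm: "norm x \<le> \<rho> \<Longrightarrow> \<bar>mpow \<alpha> x\<bar> \<le> \<rho> ^ mdeg \<alpha>"
  by (rule abs_mpow_le) (meson Basis_le_norm order_trans)

lemma majorized_mono:
  assumes "majorized c R" "0 \<le> R'" "R' \<le> R"
  shows "majorized c R'"
  unfolding majorized_def
proof (rule summable_on_comparison_test)
  show "(\<lambda>\<alpha>. \<bar>c \<alpha>\<bar> * R ^ mdeg \<alpha>) summable_on multi_indices"
    using assms by (simp add: majorized_def)
qed (use assms in \<open>auto intro!: mult_left_mono power_mono\<close>)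

lemma has_sum_mseries:
  assumes "majorized c R" "norm x \<le> R"
  shows "((\<lambda>\<alpha>. c \<alpha> * mpow \<alpha> x) has_sum mseries c x) multi_indices"
proof -
  have "(\<lambda>\<alpha>. norm (c \<alpha> * mpow \<alpha> x)) summable_on multi_indices"
    by (rule Infinite_Sum.abs_summable_on_comparison_test'[where g = "\<lambda>\<alpha>. \<bar>c \<alpha>\<bar> * R ^ mdeg \<alpha>"])
       (use assms abs_mpow_le_norm[OF assms(2)] in
        \<open>auto simp: majorized_def abs_mult intro!: mult_left_mono\<close>)
  then show ?thesis
    unfolding mseries_def by (rule has_sum_infsum[OF abs_summable_summable])
qed

text \<open>Unordered summability of reals is automatically absolute, so convergence at one point
  with all coordinates equal to \<open>R\<close> already majorizes the coefficients: the monomials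
  there are exactly \<open>R ^ mdeg \<alpha>\<close>.\<close>

lemma majorized_of_has_sum:
  fixes c :: "('a::euclidean_space \<Rightarrow> nat) \<Rightarrow> real"
  assumes "0 < r" and "\<And>x. x \<in> ball 0 r \<Longrightarrow> (\<lambda>\<alpha>. c \<alpha> * mpow \<alpha> x) summable_on multi_indices"
  shows "\<exists>R>0. majorized c R"
proof -
  \<comment> \<open>The corner point has norm at most \<open>DIM('a) * R\<close>; this choice keeps
    it within \<open>r / 2\<close>.\<close>
  define R where "R = r / (2 * real DIM('a))"
  have R: "R > 0" using assms by (simp add: R_def DIM_positive)
  define x :: 'a where "x = (\<Sum>b\<in>Basis. R *\<^sub>R b)"
  have xb: "x \<bullet> b = R" if "b \<in> Basis" for b
    using that by (simp add: x_def)
  have "norm x \<le> (\<Sum>b\<in>(Basis::'a set). norm (R *\<^sub>R b))" unfolding x_def by (rule norm_sum)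
  also have "\<dots> = real DIM('a) * R" using R by simp
  also have "\<dots> = r / 2" by (simp add: R_def)
  finally have "x \<in> ball 0 r" using assms(1) by auto
  then have "(\<lambda>\<alpha>. c \<alpha> * mpow \<alpha> x) summable_on multi_indices" by (rule assms(2))
  then have "(\<lambda>\<alpha>. norm (c \<alpha> * mpow \<alpha> x)) summable_on multi_indices"
    by (simp only: summable_on_iff_abs_summable_on_real[symmetric])
  moreover have "norm (c \<alpha> * mpow \<alpha> x) = \<bar>c \<alpha>\<bar> * R ^ mdeg \<alpha>" for \<alpha>
    using R by (simp add: mpow_def xb abs_mult mdeg_def power_sum abs_prod)
  ultimately show ?thesis using R unfolding majorized_def by auto
qed

section \<open>Differentiating power series term by term\<close>

lemma linear_times_power_bound:
  fixes R R' :: real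
  assumes "0 < R'" "R' < R"
  shows "\<exists>K>0. \<forall>n. real (Suc n) * R' ^ n \<le> K * R ^ Suc n"
proof -
  define q where "q = R' / R"
  have q: "0 < q" "q < 1" using assms by (auto simp: q_def)
  have "real (Suc n) * R' ^ n \<le> (1 / ((1 - q) * R)) * R ^ Suc n" for n
  proof -
    \<comment> \<open>Each of the n + 1 copies of \<open>q ^ n\<close> is at most one of the powers
      \<open>q ^ i\<close>, so a geometric sum absorbs the linear factor.\<close>
    have "real (Suc n) * q ^ n = (\<Sum>i<Suc n. q ^ n)" by simp
    also have "\<dots> \<le> (\<Sum>i<Suc n. q ^ i)"
      using q by (intro sum_mono power_decreasing) auto
    also have "\<dots> \<le> 1 / (1 - q)"
      using q by (subst sum_gp_strict) (auto simp: divide_right_mono)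
    finally have "real (Suc n) * q ^ n * R ^ n \<le> 1 / (1 - q) * R ^ n"
      using assms by (intro mult_right_mono) auto
    moreover have "q ^ n * R ^ n = R' ^ n"
      using assms by (simp add: q_def power_divide)
    moreover have "1 / (1 - q) * R ^ n = (1 / ((1 - q) * R)) * R ^ Suc n"
      using assms q by simp
    ultimately show ?thesis by (simp only: mult.assoc)
  qed
  moreover have "1 / ((1 - q) * R) > 0" using q assms by simp
  ultimately show ?thesis by blast
qed

lemma inj_on_multi_index_Suc: "inj_on (\<lambda>\<alpha>. \<alpha>(b := Suc (\<alpha> b))) A"
proof (rule inj_onI)
  fix \<alpha> \<beta> :: "'a \<Rightarrow> nat" assume *: "\<alpha>(b := Suc (\<alpha> b)) = \<beta>(b := Suc (\<beta> b))"
  show "\<alpha> = \<beta>"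
  proof
    fix x from fun_cong[OF *, of x] show "\<alpha> x = \<beta> x" by (auto split: if_splits)
  qed
qed

lemma multi_index_Suc_image:
  assumes "b \<in> Basis"
  shows "(\<lambda>\<alpha>. \<alpha>(b := Suc (\<alpha> b))) ` multi_indices = {\<alpha> \<in> multi_indices. \<alpha> b \<noteq> 0}"
proof (intro equalityI subsetI)
  fix \<alpha> assume "\<alpha> \<in> {\<alpha> \<in> multi_indices. \<alpha> b \<noteq> 0}"
  then have "\<alpha> = (\<alpha>(b := \<alpha> b - 1))(b := Suc ((\<alpha>(b := \<alpha> b - 1)) b))" "\<alpha>(b := \<alpha> b - 1) \<in> multi_indices"
    using assms by (auto simp: multi_indices_upd)
  then show "\<alpha> \<in> (\<lambda>\<alpha>. \<alpha>(b := Suc (\<alpha> b))) ` multi_indices" by blast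
qed (use assms in \<open>auto simp: multi_indices_upd\<close>)

text \<open>Shifting the exponent of \<open>b\<close> costs the factor
  \<open>\<alpha> b + 1\<close>, at most \<open>mdeg \<alpha> + 1\<close>, which the drop from
  \<open>R\<close> to \<open>R'\<close> absorbs.\<close>

lemma majorized_mderiv:
  fixes c :: "('a::euclidean_space \<Rightarrow> nat) \<Rightarrow> real"
  assumes "majorized c R" "0 < R'" "R' < R" "b \<in> Basis"
  shows "majorized (mderiv b c) R'"
proof -
  obtain K where K: "K > 0" "\<And>n. real (Suc n) * R' ^ n \<le> K * R ^ Suc n"
    using linear_times_power_bound assms by blast
  let ?s = "\<lambda>\<alpha>. \<alpha>(b := Suc (\<alpha> b))"
  have "(\<lambda>\<alpha>. \<bar>c \<alpha>\<bar> * R ^ mdeg \<alpha>) summable_on (?s ` multi_indices)"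
    by (rule summable_on_subset_banach) (use assms in \<open>auto simp: majorized_def multi_index_Suc_image\<close>)
  then have "(\<lambda>\<alpha>. \<bar>c (?s \<alpha>)\<bar> * R ^ mdeg (?s \<alpha>)) summable_on multi_indices"
    by (subst (asm) summable_on_reindex) (auto simp: o_def inj_on_multi_index_Suc)
  then have s: "(\<lambda>\<alpha>. K * (\<bar>c (?s \<alpha>)\<bar> * R ^ mdeg (?s \<alpha>))) summable_on multi_indices"
    by (rule summable_on_cmult_right)
  show ?thesis
    unfolding majorized_def
  proof (rule summable_on_comparison_test[OF s])
    fix \<alpha> :: "'a \<Rightarrow> nat"
    have "\<bar>mderiv b c \<alpha>\<bar> * R' ^ mdeg \<alpha> = \<bar>c (?s \<alpha>)\<bar> * (real (Suc (\<alpha> b)) * R' ^ mdeg \<alpha>)"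
      by (simp add: mderiv_def abs_mult)
    also have "\<dots> \<le> \<bar>c (?s \<alpha>)\<bar> * (real (Suc (mdeg \<alpha>)) * R' ^ mdeg \<alpha>)"
      using assms le_mdeg[OF assms(4), of \<alpha>] by (intro mult_left_mono mult_right_mono) auto
    also have "\<dots> \<le> \<bar>c (?s \<alpha>)\<bar> * (K * R ^ Suc (mdeg \<alpha>))"
      by (intro mult_left_mono K) auto
    finally show "\<bar>mderiv b c \<alpha>\<bar> * R' ^ mdeg \<alpha> \<le> K * (\<bar>c (?s \<alpha>)\<bar> * R ^ mdeg (?s \<alpha>))"
      using assms(4) by (simp add: mdeg_upd_Suc mult_ac)
  qed (use assms in auto)
qed

text \<open>The product rule. Truncated subtraction does no harm: when \<open>\<alpha> b = 0\<close>
  the factor \<open>real (\<alpha> b)\<close> removes the term.\<close>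

lemma mpow_has_derivative:
  "(mpow \<alpha> has_derivative (\<lambda>h. \<Sum>b\<in>Basis. (h \<bullet> b) * (real (\<alpha> b) * mpow (\<alpha>(b := \<alpha> b - 1)) x))) (at x within S)"
proof -
  have eq: "mpow (\<alpha>(b := \<alpha> b - 1)) x = (x \<bullet> b) ^ (\<alpha> b - 1) * (\<Prod>j\<in>Basis - {b}. (x \<bullet> j) ^ \<alpha> j)"
    if "b \<in> Basis" for b
    unfolding mpow_def using that by (subst prod.remove[of _ b]) (auto intro!: arg_cong2[where f = "(*)"] prod.cong)
  show ?thesis
    unfolding mpow_def[abs_def]
    apply (rule has_derivative_eq_rhs)
     apply (rule has_derivative_prod[OF has_derivative_power[OF has_derivative_inner_left[OF has_derivative_ident]]])
    apply (rule ext, rule sum.cong[OF refl])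
    apply (simp only: eq[unfolded mpow_def] mult_ac)
    done
qed

lemma countable_multi_indices: "countable (multi_indices :: ('a::euclidean_space \<Rightarrow> nat) set)"
proof -
  have "countable (Basis \<rightarrow>\<^sub>E (UNIV :: nat set) :: ('a \<Rightarrow> nat) set)"
    by (intro countable_PiE) auto
  moreover have "inj_on (\<lambda>\<alpha>. restrict \<alpha> Basis) (multi_indices :: ('a \<Rightarrow> nat) set)"
  proof (rule inj_onI, rule ext)
    fix \<alpha> \<beta> :: "'a \<Rightarrow> nat" and b :: 'a
    assume *: "\<alpha> \<in> multi_indices" "\<beta> \<in> multi_indices" "restrict \<alpha> Basis = restrict \<beta> Basis"
    show "\<alpha> b = \<beta> b"
      using *(1,2) fun_cong[OF *(3), of b] by (cases "b \<in> Basis") (auto simp: multi_indices_def)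
  qed
  moreover have "(\<lambda>\<alpha>. restrict \<alpha> Basis) ` multi_indices \<subseteq> (Basis \<rightarrow>\<^sub>E (UNIV :: nat set) :: ('a \<Rightarrow> nat) set)"
    by auto
  ultimately show ?thesis
    by (meson countable_image_inj_on countable_subset)
qed

lemma infinite_multi_indices: "infinite (multi_indices :: ('a::euclidean_space \<Rightarrow> nat) set)"
proof -
  obtain b :: 'a where b: "b \<in> Basis" using nonempty_Basis by blast
  have "inj (\<lambda>n x. if x = b then n else (0::nat))"
    by (rule injI) (auto dest: fun_cong[where x = b])
  moreover have "range (\<lambda>n x. if x = b then n else (0::nat)) \<subseteq> multi_indices"
    using b by (auto simp: multi_indices_def)
  ultimately show ?thesis
    using infinite_iff_countable_subset by blast
qed

lemma has_sum_sum':
  fixes f :: "'i \<Rightarrow> 'a \<Rightarrow> 'b::topological_comm_monoid_add"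
  assumes "\<And>i. i \<in> I \<Longrightarrow> (f i has_sum s i) A"
  shows "((\<lambda>x. \<Sum>i\<in>I. f i x) has_sum (\<Sum>i\<in>I. s i)) A"
  using assms by (induction I rule: infinite_finite_induct) (auto intro: has_sum_add)

text \<open>Terms with \<open>\<alpha> b = 0\<close> vanish, and the shift in \<open>b\<close> is a
  bijection onto the remaining exponents, so this is the derived series reindexed.\<close>

lemma has_sum_term_derivative:
  fixes c :: "('a::euclidean_space \<Rightarrow> nat) \<Rightarrow> real"
  assumes "majorized c R" "norm x < R" "b \<in> Basis"
  shows "((\<lambda>\<alpha>. c \<alpha> * (real (\<alpha> b) * mpow (\<alpha>(b := \<alpha> b - 1)) x)) has_sum mseries (mderiv b c) x) multi_indices"
proof -
  obtain R' where R': "norm x < R'" "R' < R" using assms dense by blast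
  then have "0 < R'" by (meson norm_ge_zero order_le_less_trans)
  then have "((\<lambda>\<alpha>. mderiv b c \<alpha> * mpow \<alpha> x) has_sum mseries (mderiv b c) x) multi_indices"
    using R' assms by (intro has_sum_mseries[where R = R'] majorized_mderiv[where R = R]) auto
  moreover have "mderiv b c \<alpha> * mpow \<alpha> x =
     ((\<lambda>\<alpha>. c \<alpha> * (real (\<alpha> b) * mpow (\<alpha>(b := \<alpha> b - 1)) x)) \<circ> (\<lambda>\<alpha>. \<alpha>(b := Suc (\<alpha> b)))) \<alpha>" for \<alpha>
    by (simp add: mderiv_def)
  ultimately have "((\<lambda>\<alpha>. c \<alpha> * (real (\<alpha> b) * mpow (\<alpha>(b := \<alpha> b - 1)) x)) has_sum mseries (mderiv b c) x)
      {\<alpha> \<in> multi_indices. \<alpha> b \<noteq> 0}"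
    unfolding multi_index_Suc_image[OF assms(3), symmetric]
    by (subst has_sum_reindex[OF inj_on_multi_index_Suc]) (simp only: o_def)
  then show ?thesis
    by (subst has_sum_cong_neutral[where T = "{\<alpha> \<in> multi_indices. \<alpha> b \<noteq> 0}"]) auto
qed

text \<open>A Weierstrass M-test: on a smaller ball the differentiated terms have a summable bound
  independent of the point, so differentiation and summation commute.\<close>

lemma mseries_has_derivative:
  fixes c :: "('a::euclidean_space \<Rightarrow> nat) \<Rightarrow> real"
  assumes "majorized c R" "norm x < R"
  shows "(mseries c has_derivative (\<lambda>h. \<Sum>b\<in>Basis. (h \<bullet> b) * mseries (mderiv b c) x)) (at x)"
proof -
  obtain R' where R': "norm x < R'" "R' < R" using assms dense by blast
  then have "0 < R'" by (meson norm_ge_zero order_le_less_trans)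
  obtain K where K: "K > 0" "\<And>n. real (Suc n) * R' ^ n \<le> K * R ^ Suc n"
    using linear_times_power_bound \<open>0 < R'\<close> R' by blast
  \<comment> \<open>An enumeration turns unordered sums into ordinary series, to which termwise
    differentiation applies.\<close>
  define e where "e = from_nat_into (multi_indices :: ('a \<Rightarrow> nat) set)"
  have e: "bij_betw e UNIV multi_indices"
    unfolding e_def by (intro bij_betw_from_nat_into countable_multi_indices infinite_multi_indices)
  then have e_in: "e i \<in> multi_indices" for i by (auto simp: bij_betw_def)
  define D where "D \<alpha> x h = (\<Sum>b\<in>Basis. (h \<bullet> b) * (c \<alpha> * (real (\<alpha> b) * mpow (\<alpha>(b := \<alpha> b - 1)) x)))"
    for \<alpha> and x h :: 'a
  define g' where "g' x h = (\<Sum>b\<in>Basis. (h \<bullet> b) * mseries (mderiv b c) x)" for x h :: 'a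
  \<comment> \<open>Bounds the operator norm of \<open>D \<alpha> x\<close> on the ball of radius
    \<open>R'\<close>: one summand per basis vector, with \<open>K\<close> from the power
    estimate.\<close>
  define M where "M \<alpha> = real DIM('a) * (K * (\<bar>c \<alpha>\<bar> * R ^ mdeg \<alpha>))" for \<alpha>
  have "M summable_on multi_indices"
    unfolding M_def using assms(1) by (intro summable_on_cmult_right) (simp add: majorized_def)
  then have "(\<lambda>i. M (e i)) summable_on UNIV"
    using summable_on_reindex_bij_betw[OF e, of M] by simp
  then have M_sum: "summable (\<lambda>i. M (e i))" by (rule summable_on_imp_summable)
  have D_sums: "(\<lambda>i. D (e i) x h) sums g' x h" if "norm x < R" for x h
  proof -
    have "(D' has_sum g' x h) multi_indices" if "D' = (\<lambda>\<alpha>. D \<alpha> x h)" for D'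
      unfolding that D_def g'_def
      by (intro has_sum_sum' has_sum_cmult_right has_sum_term_derivative[OF assms(1) \<open>norm x < R\<close>]) auto
    then have "((\<lambda>\<alpha>. D \<alpha> x h) has_sum g' x h) multi_indices" by blast
    then have "((\<lambda>i. D (e i) x h) has_sum g' x h) UNIV"
      using has_sum_reindex_bij_betw[OF e, of "\<lambda>\<alpha>. D \<alpha> x h"] by simp
    then show ?thesis by (rule has_sum_imp_sums)
  qed
  have D_bound: "norm (D \<alpha> x h) \<le> M \<alpha> * norm h" if "norm x \<le> R'" for \<alpha> x h
  proof -
    have "norm (D \<alpha> x h) \<le> (\<Sum>b\<in>(Basis::'a set). norm h * (K * (\<bar>c \<alpha>\<bar> * R ^ mdeg \<alpha>)))"
      unfolding D_def
    proof (rule order_trans[OF norm_sum], rule sum_mono)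
      fix b :: 'a assume b: "b \<in> Basis"
      have 1: "real (\<alpha> b) * \<bar>mpow (\<alpha>(b := \<alpha> b - 1)) x\<bar> \<le> K * R ^ mdeg \<alpha>"
      proof (cases "\<alpha> b")
        case 0 then show ?thesis using K R' \<open>0 < R'\<close> by simp
      next
        case (Suc n)
        define \<beta> where "\<beta> = \<alpha>(b := \<alpha> b - 1)"
        have "\<alpha> = \<beta>(b := Suc (\<beta> b))" using Suc by (auto simp: \<beta>_def)
        then have deg: "mdeg \<alpha> = Suc (mdeg \<beta>)" using mdeg_upd_Suc[OF b, of \<beta>] by simp
        have "real (\<alpha> b) * \<bar>mpow \<beta> x\<bar> \<le> real (Suc (mdeg \<beta>)) * R' ^ mdeg \<beta>"
          using le_mdeg[OF b, of \<alpha>] abs_mpow_le_norm[OF that, of \<beta>] deg by (intro mult_mono) auto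
        also have "\<dots> \<le> K * R ^ mdeg \<alpha>" using K(2)[of "mdeg \<beta>"] deg by simp
        finally show ?thesis by (simp add: \<beta>_def)
      qed
      have "norm ((h \<bullet> b) * (c \<alpha> * (real (\<alpha> b) * mpow (\<alpha>(b := \<alpha> b - 1)) x)))
         = \<bar>h \<bullet> b\<bar> * (\<bar>c \<alpha>\<bar> * (real (\<alpha> b) * \<bar>mpow (\<alpha>(b := \<alpha> b - 1)) x\<bar>))"
        by (simp add: abs_mult)
      also have "\<dots> \<le> norm h * (\<bar>c \<alpha>\<bar> * (K * R ^ mdeg \<alpha>))"
        by (rule mult_mono[OF Basis_le_norm[OF b] mult_left_mono[OF 1]]) auto
      finally show "norm ((h \<bullet> b) * (c \<alpha> * (real (\<alpha> b) * mpow (\<alpha>(b := \<alpha> b - 1)) x))) \<le> norm h * (K * (\<bar>c \<alpha>\<bar> * R ^ mdeg \<alpha>))"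
        by (simp add: mult_ac)
    qed
    also have "\<dots> = M \<alpha> * norm h" by (simp add: M_def)
    finally show ?thesis .
  qed
  have f_sums: "(\<lambda>i. c (e i) * mpow (e i) y) sums mseries c y" if "norm y < R" for y
    using has_sum_reindex_bij_betw[OF e, of "\<lambda>\<alpha>. c \<alpha> * mpow \<alpha> y"] has_sum_mseries[OF assms(1), of y] that
    by (intro has_sum_imp_sums) auto
  \<comment> \<open>The tail of the majorant is small uniformly in \<open>x\<close>; the factor
    \<open>norm h\<close> makes this convergence in operator norm.\<close>
  have unif: "\<forall>\<^sub>F n in sequentially. \<forall>x\<in>ball 0 R'. \<forall>h. norm ((\<Sum>i<n. D (e i) x h) - g' x h) \<le> \<epsilon> * norm h"
    if "\<epsilon> > 0" for \<epsilon>
  proof -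
    obtain N where N: "\<And>n. n \<ge> N \<Longrightarrow> norm (\<Sum>i. M (e (i + n))) < \<epsilon>"
      using suminf_exist_split[OF \<open>\<epsilon> > 0\<close> M_sum] by blast
    have "norm ((\<Sum>i<n. D (e i) x h) - g' x h) \<le> \<epsilon> * norm h" if "n \<ge> N" "x \<in> ball 0 R'" for n x h
    proof -
      have x: "norm x \<le> R'" "norm x < R" using that R' by auto
      have s: "(\<lambda>i. D (e (i + n)) x h) sums (g' x h - (\<Sum>i<n. D (e i) x h))"
        using sums_split_initial_segment[OF D_sums[OF x(2)]] .
      have Mn: "summable (\<lambda>i. M (e (i + n)) * norm h)"
        by (intro summable_mult2 summable_ignore_initial_segment M_sum)
      have "norm (\<Sum>i. D (e (i + n)) x h) \<le> (\<Sum>i. M (e (i + n)) * norm h)"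
        by (rule norm_suminf_le) (use D_bound[OF x(1)] Mn in auto)
      also have "\<dots> = (\<Sum>i. M (e (i + n))) * norm h"
        by (intro suminf_mult2[symmetric] summable_ignore_initial_segment M_sum)
      also have "\<dots> \<le> \<epsilon> * norm h"
        using N[OF that(1)] by (intro mult_right_mono) auto
      finally show ?thesis
        using sums_unique[OF s] by (simp add: norm_minus_commute)
    qed
    then show ?thesis unfolding eventually_sequentially by blast
  qed
  have "\<exists>g. \<forall>x\<in>ball 0 R'. (\<lambda>i. c (e i) * mpow (e i) x) sums g x \<and> (g has_derivative g' x) (at x within ball 0 R')"
  proof (rule has_derivative_series[OF _ _ unif])
    show "((\<lambda>x. c (e n) * mpow (e n) x) has_derivative D (e n) y) (at y within ball 0 R')" for n y
      unfolding D_def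
      by (rule has_derivative_eq_rhs[OF has_derivative_mult_right[OF mpow_has_derivative]])
         (auto simp: sum_distrib_left mult_ac)
    show "(\<lambda>n. c (e n) * mpow (e n) x) sums mseries c x" using f_sums assms by blast
  qed (use R' in auto)
  then obtain g where g: "\<And>y. y \<in> ball 0 R' \<Longrightarrow> (\<lambda>i. c (e i) * mpow (e i) y) sums g y"
    "\<And>y. y \<in> ball 0 R' \<Longrightarrow> (g has_derivative g' y) (at y within ball 0 R')" by blast
  have x: "x \<in> ball 0 R'" using R' by simp
  have "(g has_derivative g' x) (at x)"
    using g(2)[OF x] x at_within_open[OF x open_ball] by simp
  moreover have "g y = mseries c y" if "y \<in> ball 0 R'" for y
    using sums_unique2[OF g(1)[OF that] f_sums] that R' by auto
  ultimately have "(mseries c has_derivative g' x) (at x)"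
    using has_derivative_transform_within_open[OF _ open_ball x] by blast
  then show ?thesis by (simp add: g'_def[abs_def])
qed

text \<open>What uniqueness takes from analyticity: the gradient \<open>V\<close>, its derivative
  \<open>V'\<close>, and continuity of each component of \<open>V'\<close>, expressed through its
  Riesz vector \<open>D\<close>.\<close>

lemma real_analytic_C2:
  fixes v :: "'a::euclidean_space \<Rightarrow> real"
  assumes "real_analytic_on v U" "0 \<in> U"
  obtains s V V' where "0 < s"
    "\<And>x. x \<in> ball 0 s \<Longrightarrow> (v has_derivative (\<lambda>h. V x \<bullet> h)) (at x)"
    "\<And>x. x \<in> ball 0 s \<Longrightarrow> (V has_derivative V' x) (at x)"
    "\<And>e. e \<in> Basis \<Longrightarrow> \<exists>D. continuous_on (ball 0 s) D \<and> (\<forall>x\<in>ball 0 s. \<forall>h. V' x h \<bullet> e = h \<bullet> D x)"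
proof -
  obtain r c where r: "r > 0"
    and c: "\<And>x. x \<in> ball 0 r \<Longrightarrow> ((\<lambda>\<alpha>. c \<alpha> * mpow \<alpha> x) has_sum v x) multi_indices"
  proof -
    have "\<exists>r>0. \<exists>c :: ('a \<Rightarrow> nat) \<Rightarrow> real. \<forall>x\<in>ball 0 r.
        ((\<lambda>\<alpha>. c \<alpha> * (\<Prod>b\<in>Basis. ((x - 0) \<bullet> b) ^ \<alpha> b)) has_sum v x \<bullet> 1) multi_indices"
      using assms unfolding real_analytic_on_def by (metis Basis_real_def insertI1)
    then obtain r and c :: "('a \<Rightarrow> nat) \<Rightarrow> real" where "r > 0" and "\<forall>x\<in>ball 0 r.
        ((\<lambda>\<alpha>. c \<alpha> * (\<Prod>b\<in>Basis. ((x - 0) \<bullet> b) ^ \<alpha> b)) has_sum v x \<bullet> 1) multi_indices" by blast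
    then show ?thesis using that[of r c] by (auto simp: mpow_def)
  qed
  have "\<exists>R>0. majorized c R"
    by (rule majorized_of_has_sum[OF r]) (use c in \<open>auto dest: has_sum_imp_summable\<close>)
  then obtain R0 where R0: "R0 > 0" "majorized c R0" by blast
  define R where "R = min R0 r"
  have R: "0 < R" "R \<le> r" "majorized c R"
    using R0 r majorized_mono[OF R0(2), of R] by (auto simp: R_def)
  have v_eq: "v x = mseries c x" if "x \<in> ball 0 R" for x
    using c[of x] has_sum_mseries[OF R(3), of x] that R(2) has_sum_unique by fastforce
  define V where "V x = (\<Sum>b\<in>Basis. mseries (mderiv b c) x *\<^sub>R b)" for x
  define V' where "V' x h = (\<Sum>b\<in>Basis. (\<Sum>a\<in>Basis. (h \<bullet> a) * mseries (mderiv a (mderiv b c)) x) *\<^sub>R b)"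
    for x h :: 'a
  \<comment> \<open>Every differentiation gives up some radius: \<open>R\<close>, then
    \<open>R / 2\<close>, then \<open>R / 3\<close>.\<close>
  have maj1: "majorized (mderiv b c) (R/2)" if "b \<in> Basis" for b
    using R that by (intro majorized_mderiv[OF R(3)]) auto
  have maj2: "majorized (mderiv a (mderiv b c)) (R/3)" if "a \<in> Basis" "b \<in> Basis" for a b
    using R that by (intro majorized_mderiv[OF maj1]) auto
  show ?thesis
  proof (rule that[of "R/3" V V'])
    show "0 < R/3" using R by simp
    fix x :: 'a assume x: "x \<in> ball 0 (R/3)"
    then have xR: "x \<in> ball 0 R" using R by auto
    have "(mseries c has_derivative (\<lambda>h. \<Sum>b\<in>Basis. (h \<bullet> b) * mseries (mderiv b c) x)) (at x)"
      using xR by (intro mseries_has_derivative[OF R(3)]) auto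
    moreover have "(\<Sum>b\<in>Basis. (h \<bullet> b) * mseries (mderiv b c) x) = V x \<bullet> h" for h
      unfolding V_def inner_sum_left by (intro sum.cong) (auto simp: inner_commute)
    ultimately have "(mseries c has_derivative (\<lambda>h. V x \<bullet> h)) (at x)" by simp
    then show "(v has_derivative (\<lambda>h. V x \<bullet> h)) (at x)"
      by (rule has_derivative_transform_within_open[OF _ open_ball xR]) (simp add: v_eq)
    show "(V has_derivative V' x) (at x)"
      unfolding V_def[abs_def] V'_def[abs_def]
      by (intro has_derivative_sum has_derivative_scaleR_left mseries_has_derivative[OF maj1]) (use x R in auto)
  next
    fix e :: 'a assume e: "e \<in> Basis"
    define D where "D x = (\<Sum>a\<in>Basis. mseries (mderiv a (mderiv e c)) x *\<^sub>R a)" for x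
    have "continuous_on (ball 0 (R/3)) D"
      unfolding D_def[abs_def]
    proof (intro continuous_on_sum continuous_on_scaleR continuous_on_const)
      fix a :: 'a assume a: "a \<in> Basis"
      show "continuous_on (ball 0 (R/3)) (mseries (mderiv a (mderiv e c)))"
        by (rule continuous_at_imp_continuous_on, rule ballI)
           (auto intro: has_derivative_continuous[OF mseries_has_derivative[OF maj2[OF a e]]])
    qed
    moreover have "V' x h \<bullet> e = h \<bullet> D x" for x h
      using e by (simp add: V'_def D_def inner_sum_left inner_sum_right inner_Basis if_distrib mult.commute cong: if_cong)
    ultimately show "\<exists>D. continuous_on (ball 0 (R/3)) D \<and> (\<forall>x\<in>ball 0 (R/3). \<forall>h. V' x h \<bullet> e = h \<bullet> D x)" by blast
  qed
qed

section \<open>Series indexed by words\<close>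

text \<open>Words keep the order of their letters, so powers of a sum expand over them without
  multinomial coefficients.\<close>

definition words :: "nat \<Rightarrow> 'a::euclidean_space list set" where
  "words n = {ws. set ws \<subseteq> Basis \<and> length ws = n}"

lemma finite_words [simp]: "finite (words n)"
  unfolding words_def by (rule finite_lists_length_eq) simp

lemma card_words: "card (words n :: 'a::euclidean_space list set) = DIM('a) ^ n"
  unfolding words_def by (rule card_lists_length_eq) simp

lemma words_0 [simp]: "words 0 = {[]}"
  by (auto simp: words_def)

lemma words_Suc: "words (Suc n) = (\<lambda>(b, ws). b # ws) ` (Basis \<times> words n)"
  by (force simp: words_def length_Suc_conv image_iff)

lemma sum_power_words:
  fixes f :: "'a::euclidean_space \<Rightarrow> 'c::comm_semiring_1"
  shows "(\<Sum>b\<in>Basis. f b) ^ n = (\<Sum>ws\<in>words n. prod_list (map f ws))"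
proof (induction n)
  case (Suc n)
  have "(\<Sum>ws\<in>words (Suc n). prod_list (map f ws)) = (\<Sum>(b, ws)\<in>Basis \<times> words n. f b * prod_list (map f ws))"
    unfolding words_Suc by (subst sum.reindex) (auto simp: inj_on_def case_prod_unfold)
  also have "\<dots> = (\<Sum>b\<in>Basis. f b) * (\<Sum>ws\<in>words n. prod_list (map f ws))"
    by (simp add: sum_product sum.cartesian_product)
  finally show ?case using Suc by simp
qed simp

definition wpow :: "'a::euclidean_space list \<Rightarrow> 'a \<Rightarrow> real" where
  "wpow ws y = prod_list (map (\<lambda>b. y \<bullet> b) ws)"

lemma wpow_eq_mpow: "set ws \<subseteq> Basis \<Longrightarrow> wpow ws y = mpow (count_list ws) y"
proof (induction ws)
  case (Cons b ws)
  then have b: "b \<in> Basis" by simp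
  have "mpow (count_list (b # ws)) y = (\<Prod>x\<in>Basis. (if x = b then y \<bullet> b else 1) * (y \<bullet> x) ^ count_list ws x)"
    unfolding mpow_def by (intro prod.cong) auto
  also have "\<dots> = (y \<bullet> b) * mpow (count_list ws) y"
    using b by (simp add: prod.distrib mpow_def)
  finally show ?case using Cons by (simp add: wpow_def del: count_list.simps)
qed (simp add: wpow_def mpow_def)

lemma abs_wpow_le:
  assumes "ws \<in> words n" "norm y \<le> \<rho>"
  shows "\<bar>wpow ws y\<bar> \<le> \<rho> ^ n"
  using assms(1)
proof (induction n arbitrary: ws)
  case (Suc n)
  then obtain b us where ws: "ws = b # us" "b \<in> Basis" "us \<in> words n" by (auto simp: words_Suc)
  have "\<bar>y \<bullet> b\<bar> * \<bar>wpow us y\<bar> \<le> \<rho> * \<rho> ^ n"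
    using ws Suc.IH assms(2) Basis_le_norm[OF ws(2), of y]
    by (intro mult_mono) (auto intro: order_trans[OF norm_ge_zero])
  then show ?case by (simp add: ws wpow_def abs_mult)
qed (simp add: wpow_def)

lemma length_eq_mdeg_count: "set ws \<subseteq> Basis \<Longrightarrow> length ws = mdeg (count_list ws)"
  unfolding mdeg_def
proof (induction ws)
  case (Cons b ws)
  have "(\<Sum>x\<in>Basis. count_list (b # ws) x) = (\<Sum>x\<in>Basis. (if x = b then 1 else 0) + count_list ws x)"
    by (intro sum.cong) auto
  then show ?case using Cons by (simp add: sum.distrib)
qed simp

text \<open>A series indexed by words becomes a power series once words with the same letter
  counts are collected.\<close>
lemma has_sum_of_word_series:
  fixes T :: "'a::euclidean_space list \<Rightarrow> real"
  assumes T: "\<And>n ws. ws \<in> words n \<Longrightarrow> \<bar>T ws\<bar> \<le> C * K ^ n"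
    and K: "0 \<le> K" "0 \<le> \<rho>" "real DIM('a) * K * \<rho> < 1"
  shows "\<exists>c. \<forall>y S. norm y \<le> \<rho> \<longrightarrow> (\<lambda>n. \<Sum>ws\<in>words n. T ws * wpow ws y) sums S \<longrightarrow>
     ((\<lambda>\<alpha>. c \<alpha> * mpow \<alpha> y) has_sum S) multi_indices"
proof -
  \<comment> \<open>Words that spell the monomial \<open>\<alpha>\<close> have length
    \<open>mdeg \<alpha>\<close>; building this into the definition makes finiteness
    immediate.\<close>
  define W where "W \<alpha> = {ws \<in> words (mdeg \<alpha>). count_list ws = \<alpha>}" for \<alpha> :: "'a \<Rightarrow> nat"
  have finW: "finite (W \<alpha>)" for \<alpha>
    unfolding W_def by simp
  define c where "c \<alpha> = (\<Sum>ws\<in>W \<alpha>. T ws)" for \<alpha>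
  have "((\<lambda>\<alpha>. c \<alpha> * mpow \<alpha> y) has_sum S) multi_indices"
    if y: "norm y \<le> \<rho>" and S: "(\<lambda>n. \<Sum>ws\<in>words n. T ws * wpow ws y) sums S" for y S
  proof -
    define F where "F ws = T ws * wpow ws y" for ws
    have "0 \<le> C" using T[of "[]" 0] by simp
    have F_bound: "\<bar>F ws\<bar> \<le> C * (K * \<rho>) ^ n" if "ws \<in> words n" for n ws
    proof -
      have "\<bar>F ws\<bar> \<le> (C * K ^ n) * \<rho> ^ n"
        unfolding F_def abs_mult
        using T[OF that] abs_wpow_le[OF that y] K \<open>0 \<le> C\<close> by (intro mult_mono) auto
      then show ?thesis by (simp add: power_mult_distrib mult_ac)
    qed
    \<comment> \<open>There are \<open>DIM('a) ^ n\<close> words of length \<open>n\<close>, whence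
      the dimension in the smallness condition on \<open>\<rho>\<close>.\<close>
    have g1: "\<bar>\<Sum>ws\<in>words n. \<bar>F ws\<bar>\<bar> \<le> C * (real DIM('a) * K * \<rho>) ^ n" for n
    proof -
      have "(\<Sum>ws\<in>words n. \<bar>F ws\<bar>) \<le> (\<Sum>ws\<in>(words n :: 'a list set). C * (K * \<rho>) ^ n)"
        by (intro sum_mono F_bound)
      then show ?thesis
        by (simp add: card_words power_mult_distrib mult_ac sum_nonneg)
    qed
    have "summable (\<lambda>n. C * (real DIM('a) * K * \<rho>) ^ n)"
      using K by (intro summable_mult summable_geometric) auto
    then have "summable (\<lambda>n. norm (\<Sum>ws\<in>words n. \<bar>F ws\<bar>))"
      by (rule summable_comparison_test') (use g1 in auto)
    then have g2: "(\<lambda>n. \<Sum>ws\<in>words n. \<bar>F ws\<bar>) summable_on UNIV"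
      by (rule norm_summable_imp_summable_on)
    have "(\<lambda>p. \<bar>F (snd p)\<bar>) summable_on (Sigma UNIV words)"
      by (rule summable_on_SigmaI[OF _ g2]) (auto intro: has_sum_finiteI)
    then have "(\<lambda>p. F (snd p)) summable_on (Sigma UNIV words)"
      by (rule abs_summable_summable[where f = "\<lambda>p. F (snd p)", unfolded real_norm_def])
    then obtain S' where S': "((\<lambda>p. F (snd p)) has_sum S') (Sigma UNIV words)"
      by (auto simp: summable_on_def)
    have "((\<lambda>n. \<Sum>ws\<in>words n. F ws) has_sum S') UNIV"
      by (rule has_sum_Sigma'[OF S']) (auto intro: has_sum_finiteI)
    then have "S' = S"
      using S sums_unique2 unfolding F_def by (blast dest: has_sum_imp_sums)
    \<comment> \<open>The same words are labelled by length on one side and by letter counts on the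
      other, so both index sets give the same sum.\<close>
    have "((\<lambda>p. F (snd p)) has_sum S') (Sigma multi_indices W) \<longleftrightarrow> ((\<lambda>p. F (snd p)) has_sum S') (Sigma UNIV words)"
    proof (rule has_sum_reindex_bij_witness[where j = "\<lambda>p. (length (snd p), snd p)" and i = "\<lambda>p. (count_list (snd p), snd p)"])
      fix p :: "nat \<times> 'a list" assume "p \<in> Sigma UNIV words"
      then have p: "set (snd p) \<subseteq> Basis" "length (snd p) = fst p" by (auto simp: words_def)
      have "count_list (snd p) b = 0" if "b \<notin> Basis" for b
        using p that by (auto simp: count_list_0_iff)
      then show "(count_list (snd p), snd p) \<in> Sigma multi_indices W"
        using p length_eq_mdeg_count[OF p(1)] by (auto simp: multi_indices_def W_def words_def)
    qed (auto simp: W_def words_def)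
    then have "((\<lambda>p. F (snd p)) has_sum S) (Sigma multi_indices W)"
      using S' \<open>S' = S\<close> by simp
    then have "((\<lambda>\<alpha>. \<Sum>ws\<in>W \<alpha>. F ws) has_sum S) multi_indices"
      by (rule has_sum_Sigma') (auto intro: has_sum_finiteI finW)
    moreover have "(\<Sum>ws\<in>W \<alpha>. F ws) = c \<alpha> * mpow \<alpha> y" for \<alpha>
      unfolding c_def F_def sum_distrib_right
      by (intro sum.cong) (auto simp: W_def words_def wpow_eq_mpow)
    ultimately show ?thesis by simp
  qed
  then show ?thesis by blast
qed

section \<open>Holomorphic extension of analytic curves\<close>

lemma real_analytic_holomorphic_extension:
  fixes f :: "real \<Rightarrow> 'b::euclidean_space"
  assumes "real_analytic_on f U" "0 \<in> U" "j \<in> Basis"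
  shows "\<exists>r>0. \<exists>F. F holomorphic_on ball 0 r \<and> (\<forall>t. \<bar>t\<bar> < r \<longrightarrow> F (of_real t) = of_real (f t \<bullet> j))"
proof -
  obtain r and c :: "(real \<Rightarrow> nat) \<Rightarrow> real" where r: "r > 0"
    and c: "\<And>x. x \<in> ball 0 r \<Longrightarrow>
      ((\<lambda>\<alpha>. c \<alpha> * (\<Prod>b\<in>Basis. ((x - 0) \<bullet> b) ^ \<alpha> b)) has_sum (f x \<bullet> j)) multi_indices"
    using assms unfolding real_analytic_on_def by blast
  \<comment> \<open>In dimension one the basis is \<open>{1}\<close>, so a multi-index is a single
    exponent.\<close>
  define idx :: "nat \<Rightarrow> real \<Rightarrow> nat" where "idx n = (\<lambda>b. if b = 1 then n else 0)" for n
  have idx: "bij_betw idx UNIV multi_indices"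
  proof (rule bij_betwI[where g = "\<lambda>\<alpha>. \<alpha> 1"])
    show "idx (\<alpha> 1) = \<alpha>" if "\<alpha> \<in> multi_indices" for \<alpha>
      using that by (auto simp: idx_def multi_indices_def)
  qed (auto simp: idx_def multi_indices_def)
  define a where "a n = c (idx n)" for n
  have sums: "(\<lambda>n. a n * t ^ n) sums (f t \<bullet> j)" if "\<bar>t\<bar> < r" for t
  proof -
    have "((\<lambda>n. c (idx n) * (\<Prod>b\<in>Basis. ((t - 0) \<bullet> b) ^ idx n b)) has_sum (f t \<bullet> j)) UNIV"
      using c[of t] that has_sum_reindex_bij_betw[OF idx, of "\<lambda>\<alpha>. c \<alpha> * (\<Prod>b\<in>Basis. ((t - 0) \<bullet> b) ^ \<alpha> b)"]
      by auto
    then show ?thesis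
      by (intro has_sum_imp_sums) (simp add: a_def idx_def)
  qed
  define F where "F z = (\<Sum>n. complex_of_real (a n) * z ^ n)" for z
  have F: "(\<lambda>n. complex_of_real (a n) * z ^ n) sums F z" if z: "norm z < r" for z
  proof -
    \<comment> \<open>Convergence at a real point farther from 0 than \<open>z\<close> forces
      convergence at \<open>z\<close>.\<close>
    obtain t where t: "norm z < t" "t < r" using dense[OF z] by blast
    then have t': "\<bar>t\<bar> < r" by (smt (verit) norm_ge_zero)
    have "(\<lambda>n. complex_of_real (a n * t ^ n)) sums of_real (f t \<bullet> j)"
      using sums[OF t'] by (rule sums_of_real)
    then have "summable (\<lambda>n. complex_of_real (a n) * of_real t ^ n)"
      by (simp add: sums_iff)
    then have "summable (\<lambda>n. complex_of_real (a n) * z ^ n)"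
      by (rule powser_inside) (use t norm_ge_zero[of z] in auto)
    then show ?thesis unfolding F_def by (rule summable_sums)
  qed
  have "F holomorphic_on ball 0 r"
    by (rule power_series_holomorphic[where a = "\<lambda>n. complex_of_real (a n)"]) (use F in auto)
  moreover have "F (of_real t) = of_real (f t \<bullet> j)" if "\<bar>t\<bar> < r" for t
  proof -
    have "(\<lambda>n. complex_of_real (a n * t ^ n)) sums of_real (f t \<bullet> j)"
      using sums[OF that] by (rule sums_of_real)
    moreover have "(\<lambda>n. complex_of_real (a n * t ^ n)) sums F (of_real t)"
      using F[of "of_real t"] that by simp
    ultimately show ?thesis using sums_unique2 by blast
  qed
  ultimately show ?thesis using r by blast
qed

section \<open>Functions constant along level sets\<close>

text \<open>In a chart whose \<open>e\<close>-coordinate is \<open>\<psi>\<close>, level sets become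
  flat slices. A function whose derivative kills the tangent vectors of level sets is constant on
  segments within a slice, so its value can be read off where the level set meets the axis, at
  \<open>\<tau> x *\<^sub>R e\<close>.\<close>

lemma level_set_retraction:
  fixes \<psi> :: "'a::euclidean_space \<Rightarrow> real" and D :: "'a \<Rightarrow> 'a"
  assumes e: "e \<in> Basis" and s: "0 < s" and "\<psi> 0 = 0"
    and \<psi>: "\<And>x. x \<in> ball 0 s \<Longrightarrow> (\<psi> has_derivative (\<lambda>h. h \<bullet> D x)) (at x)"
    and D: "continuous_on (ball 0 s) D" "D 0 \<bullet> e \<noteq> 0"
  obtains \<epsilon> \<tau> where "0 < \<epsilon>" "\<epsilon> \<le> s"
    "\<And>x. x \<in> ball 0 \<epsilon> \<Longrightarrow> \<tau> differentiable (at x)"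
    "\<And>x. x \<in> ball 0 \<epsilon> \<Longrightarrow> \<tau> x *\<^sub>R e \<in> ball 0 s"
    "\<And>x. x \<in> ball 0 \<epsilon> \<Longrightarrow> \<psi> (\<tau> x *\<^sub>R e) = \<psi> x" "\<tau> 0 = 0"
    "\<And>(f :: 'a \<Rightarrow> 'b::real_normed_vector) f' x. (\<And>z. z \<in> ball 0 s \<Longrightarrow> (f has_derivative f' z) (at z)) \<Longrightarrow>
       (\<And>z h. z \<in> ball 0 s \<Longrightarrow> h \<bullet> D z = 0 \<Longrightarrow> f' z h = 0) \<Longrightarrow> x \<in> ball 0 \<epsilon> \<Longrightarrow> f x = f (\<tau> x *\<^sub>R e)"
proof -
  have ee: "e \<bullet> e = 1" using e by simp
  \<comment> \<open>the chart that replaces the \<open>e\<close>-coordinate by \<open>\<psi>\<close>\<close>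
  define \<Psi> where "\<Psi> x = x + (\<psi> x - x \<bullet> e) *\<^sub>R e" for x
  define \<Psi>' where "\<Psi>' x = Blinfun (\<lambda>h. h + (h \<bullet> D x - h \<bullet> e) *\<^sub>R e)" for x
  have \<Psi>'_apply: "blinfun_apply (\<Psi>' x) = (\<lambda>h. h + (h \<bullet> D x - h \<bullet> e) *\<^sub>R e)" for x
    unfolding \<Psi>'_def by (rule bounded_linear_Blinfun_apply) (intro bounded_linear_intros)
  \<comment> \<open>A left inverse of the derivative of \<open>\<Psi>\<close> at 0, found by solving
    for the \<open>e\<close>-coordinate; this is where \<open>D 0 \<bullet> e \<noteq> 0\<close>
    enters.\<close>
  define I where "I = Blinfun (\<lambda>h. h + ((h \<bullet> e - h \<bullet> D 0) / (D 0 \<bullet> e)) *\<^sub>R e)"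
  have I_apply: "blinfun_apply I = (\<lambda>h. h + ((h \<bullet> e - h \<bullet> D 0) / (D 0 \<bullet> e)) *\<^sub>R e)"
    unfolding I_def divide_inverse
    by (rule bounded_linear_Blinfun_apply) (intro bounded_linear_intros)
  have I: "I o\<^sub>L \<Psi>' 0 = id_blinfun"
  proof (rule blinfun_eqI)
    fix h
    have "((h + (h \<bullet> D 0 - h \<bullet> e) *\<^sub>R e) \<bullet> e - (h + (h \<bullet> D 0 - h \<bullet> e) *\<^sub>R e) \<bullet> D 0) / (D 0 \<bullet> e)
        = - (h \<bullet> D 0 - h \<bullet> e)"
      using D(2) ee by (simp add: inner_simps field_simps inner_commute)
    then show "blinfun_apply (I o\<^sub>L \<Psi>' 0) h = blinfun_apply id_blinfun h"
      by (simp add: I_apply \<Psi>'_apply scaleR_diff_left)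
  qed
  have d\<Psi>: "(\<Psi> has_derivative blinfun_apply (\<Psi>' x)) (at x)" if "x \<in> ball 0 s" for x
    unfolding \<Psi>'_apply \<Psi>_def[abs_def]
    by (intro has_derivative_add has_derivative_scaleR_left has_derivative_diff \<psi> that
        has_derivative_inner_left has_derivative_ident)
  have cont: "continuous_on (ball 0 s) \<Psi>'"
    by (rule continuous_on_blinfun_componentwise)
       (auto simp: \<Psi>'_apply intro!: continuous_intros D)
  obtain U V \<Phi> \<Phi>' where U: "open U" "U \<subseteq> ball 0 s" "0 \<in> U" and V: "open V" "\<Psi> 0 \<in> V"
    and hom: "homeomorphism U V \<Psi> \<Phi>"
    and \<Phi>: "\<And>y. y \<in> V \<Longrightarrow> (\<Phi> has_derivative \<Phi>' y) (at y)"
      "\<And>y. y \<in> V \<Longrightarrow> \<Phi>' y = inv (blinfun_apply (\<Psi>' (\<Phi> y)))"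
      "\<And>y. y \<in> V \<Longrightarrow> bij (blinfun_apply (\<Psi>' (\<Phi> y)))"
    by (rule inverse_function_theorem[OF open_ball d\<Psi> cont _ I]) (use s in auto)
  have \<Psi>0: "\<Psi> 0 = 0" using assms(3) by (simp add: \<Psi>_def)
  then obtain \<delta> where \<delta>: "\<delta> > 0" "ball 0 \<delta> \<subseteq> V" using V open_contains_ball by metis
  have "continuous_on U \<Psi>" using hom by (simp add: homeomorphism_def)
  then have "open (\<Psi> -` ball 0 \<delta> \<inter> U)"
    using U(1) by (auto simp: continuous_on_open_vimage)
  moreover have "0 \<in> \<Psi> -` ball 0 \<delta> \<inter> U" using \<Psi>0 \<delta> U by simp
  ultimately obtain \<epsilon> where \<epsilon>: "\<epsilon> > 0" "ball 0 \<epsilon> \<subseteq> \<Psi> -` ball 0 \<delta> \<inter> U"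
    using open_contains_ball by metis
  define \<epsilon>' where "\<epsilon>' = min \<epsilon> s"
  define \<tau> where "\<tau> x = \<Phi> (\<psi> x *\<^sub>R e) \<bullet> e" for x
  have \<Psi>e: "\<Psi> x \<bullet> e = \<psi> x" for x by (simp add: \<Psi>_def inner_simps ee)
  have in\<delta>: "\<psi> x *\<^sub>R e \<in> ball 0 \<delta>" if "x \<in> ball 0 \<epsilon>'" for x
  proof -
    have "norm (\<psi> x *\<^sub>R e) = \<bar>\<Psi> x \<bullet> e\<bar>" using e by (simp add: \<Psi>e)
    also have "\<dots> \<le> norm (\<Psi> x)" by (rule Basis_le_norm[OF e])
    also have "\<dots> < \<delta>" using \<epsilon>(2) that by (auto simp: \<epsilon>'_def)
    finally show ?thesis by simp
  qed
  have \<Phi>\<Psi>: "\<Phi> (\<Psi> x) = x" if "x \<in> U" for x using hom that by (simp add: homeomorphism_def)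
  have \<Psi>\<Phi>: "\<Psi> (\<Phi> y) = y" "\<Phi> y \<in> U" if "y \<in> V" for y using hom that by (auto simp: homeomorphism_def)
  have \<tau>: "\<tau> x *\<^sub>R e = \<Phi> (\<psi> x *\<^sub>R e)" "\<tau> x *\<^sub>R e \<in> U" "\<psi> (\<tau> x *\<^sub>R e) = \<psi> x" if "x \<in> ball 0 \<epsilon>'" for x
  proof -
    define z where "z = \<Phi> (\<psi> x *\<^sub>R e)"
    have z: "\<Psi> z = \<psi> x *\<^sub>R e" "z \<in> U" using \<Psi>\<Phi>[OF subsetD[OF \<delta>(2) in\<delta>[OF that]]] by (auto simp: z_def)
    have "\<psi> z = \<psi> x" using \<Psi>e[of z] z ee by simp
    \<comment> \<open>The chart moves points only along \<open>e\<close>, so a point whose image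
      lies on the axis lies on the axis itself.\<close>
    then have "z = (z \<bullet> e) *\<^sub>R e" using z(1) by (simp add: \<Psi>_def algebra_simps)
    then show *: "\<tau> x *\<^sub>R e = \<Phi> (\<psi> x *\<^sub>R e)" by (simp add: \<tau>_def z_def)
    show "\<tau> x *\<^sub>R e \<in> U" "\<psi> (\<tau> x *\<^sub>R e) = \<psi> x"
      using z \<open>\<psi> z = \<psi> x\<close> unfolding * z_def by auto
  qed
  show ?thesis
  proof (rule that[of \<epsilon>' \<tau>])
    show "0 < \<epsilon>'" "\<epsilon>' \<le> s" using \<epsilon> s by (auto simp: \<epsilon>'_def)
    have "\<Phi> 0 = 0" using \<Phi>\<Psi>[OF U(3)] \<Psi>0 by simp
    then show "\<tau> 0 = 0" using assms(3) by (simp add: \<tau>_def)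
    fix x :: 'a assume x: "x \<in> ball 0 \<epsilon>'"
    show "\<tau> x *\<^sub>R e \<in> ball 0 s" "\<psi> (\<tau> x *\<^sub>R e) = \<psi> x" using \<tau>[OF x] U by auto
    have "\<psi> x *\<^sub>R e \<in> V" by (rule subsetD[OF \<delta>(2) in\<delta>[OF x]])
    moreover have "(\<psi> has_derivative (\<lambda>h. h \<bullet> D x)) (at x)" using \<psi> x by (simp add: \<epsilon>'_def)
    ultimately have "((\<lambda>x. \<Phi> (\<psi> x *\<^sub>R e)) has_derivative (\<lambda>h. \<Phi>' (\<psi> x *\<^sub>R e) ((h \<bullet> D x) *\<^sub>R e))) (at x)"
      using has_derivative_compose[OF has_derivative_scaleR_left \<Phi>(1)] by blast
    then show "\<tau> differentiable (at x)"
      unfolding \<tau>_def[abs_def] differentiable_def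
      using has_derivative_inner_left by blast
    fix f :: "'a \<Rightarrow> 'b" and f'
    assume f: "\<And>z. z \<in> ball 0 s \<Longrightarrow> (f has_derivative f' z) (at z)"
      and f0: "\<And>z h. z \<in> ball 0 s \<Longrightarrow> h \<bullet> D z = 0 \<Longrightarrow> f' z h = 0"
    \<comment> \<open>The chart images of \<open>x\<close> and of
      \<open>\<tau> x *\<^sub>R e\<close> differ by \<open>d\<close>, which is orthogonal to
      \<open>e\<close>: the segment between them stays in one slice.\<close>
    define d where "d = \<psi> x *\<^sub>R e - \<Psi> x"
    have de: "d \<bullet> e = 0" by (simp add: d_def inner_simps \<Psi>e ee)
    have x\<delta>: "\<Psi> x \<in> ball 0 \<delta>" "x \<in> U" using x \<epsilon>(2) by (auto simp: \<epsilon>'_def)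
    have seg: "\<Psi> x + t *\<^sub>R d \<in> ball 0 \<delta>" if "t \<in> {0..1}" for t
    proof -
      have "\<Psi> x + t *\<^sub>R d = (1 - t) *\<^sub>R \<Psi> x + t *\<^sub>R (\<psi> x *\<^sub>R e)" by (simp add: d_def algebra_simps)
      then show ?thesis using convexD[OF convex_ball x\<delta>(1) in\<delta>[OF x], of "1 - t" t] that by auto
    qed
    have "((\<lambda>t. f (\<Phi> (\<Psi> x + t *\<^sub>R d))) has_derivative (\<lambda>h. 0)) (at t within {0..1})" if "t \<in> {0..1}" for t
    proof -
      define w where "w = \<Psi> x + t *\<^sub>R d"
      have w: "w \<in> V" unfolding w_def by (rule subsetD[OF \<delta>(2) seg[OF that]])
      then have "\<Phi> w \<in> ball 0 s" using \<Psi>\<Phi>(2) U by blast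
      have "((\<lambda>t. \<Psi> x + t *\<^sub>R d) has_derivative (\<lambda>h. h *\<^sub>R d)) (at t within {0..1})"
        by (auto intro!: derivative_eq_intros)
      then have "((\<lambda>t. \<Phi> (\<Psi> x + t *\<^sub>R d)) has_derivative (\<lambda>h. \<Phi>' w (h *\<^sub>R d))) (at t within {0..1})"
        by (rule has_derivative_compose) (use \<Phi>(1)[OF w] w_def in simp)
      then have "((\<lambda>t. f (\<Phi> (\<Psi> x + t *\<^sub>R d))) has_derivative (\<lambda>h. f' (\<Phi> w) (\<Phi>' w (h *\<^sub>R d)))) (at t within {0..1})"
        by (rule has_derivative_compose) (use f[OF \<open>\<Phi> w \<in> ball 0 s\<close>] w_def in simp)
      \<comment> \<open>Pulled back by the chart, a direction orthogonal to \<open>e\<close> is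
        tangent to a level set of \<open>\<psi>\<close>, so the hypothesis on \<open>f'\<close>
        applies.\<close>
      moreover have "f' (\<Phi> w) (\<Phi>' w (h *\<^sub>R d)) = 0" for h
      proof (rule f0[OF \<open>\<Phi> w \<in> ball 0 s\<close>])
        have "blinfun_apply (\<Psi>' (\<Phi> w)) (\<Phi>' w (h *\<^sub>R d)) = h *\<^sub>R d"
          using \<Phi>(2,3)[OF w] by (simp add: bij_is_surj surj_f_inv_f)
        then have "(\<Phi>' w (h *\<^sub>R d) + (\<Phi>' w (h *\<^sub>R d) \<bullet> D (\<Phi> w) - \<Phi>' w (h *\<^sub>R d) \<bullet> e) *\<^sub>R e) \<bullet> e = h *\<^sub>R d \<bullet> e"
          unfolding \<Psi>'_apply by metis
        then show "\<Phi>' w (h *\<^sub>R d) \<bullet> D (\<Phi> w) = 0" using de ee by (simp add: inner_simps)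
      qed
      ultimately show ?thesis by simp
    qed
    then obtain c where "\<And>t. t \<in> {0..1} \<Longrightarrow> f (\<Phi> (\<Psi> x + t *\<^sub>R d)) = c"
      using has_derivative_zero_constant[of "{0..1::real}" "\<lambda>t. f (\<Phi> (\<Psi> x + t *\<^sub>R d))"] by auto
    from this[of 0] this[of 1] show "f x = f (\<tau> x *\<^sub>R e)"
      using \<Phi>\<Psi>[OF x\<delta>(2)] by (simp add: \<tau>(1)[OF x] d_def)
  qed
qed

section \<open>The envelope of a slope curve\<close>

text \<open>\<open>G b\<close> extends the component \<open>g \<bullet> b\<close> to a complex disc.
  The two smallness conditions on \<open>r\<close> ensure, for \<open>norm x \<le> r\<close>, that
  \<open>\<phi> x\<close> below maps the closed disc of radius \<open>\<rho>\<close> into the disc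
  of half that radius and contracts it by 1/2.\<close>

locale gauss_curve =
  fixes e :: "'a::euclidean_space" and g :: "real \<Rightarrow> 'a" and G :: "'a \<Rightarrow> complex \<Rightarrow> complex"
    and R \<rho> M r :: real
  assumes e_Basis: "e \<in> Basis"
    and \<rho>: "0 < \<rho>" "\<rho> < R" and M: "0 < M"
    and r: "0 < r" "real DIM('a) * M * r \<le> \<rho> / 2" "real DIM('a) * M * r \<le> 1 / 2"
    and G_holo: "\<And>b. b \<in> Basis \<Longrightarrow> G b holomorphic_on ball 0 R"
    and G_real: "\<And>b t. b \<in> Basis \<Longrightarrow> \<bar>t\<bar> < R \<Longrightarrow> G b (of_real t) = of_real (g t \<bullet> b)"
    and A_nz: "\<And>w. w \<in> ball 0 R \<Longrightarrow> deriv (G e) w \<noteq> 0"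
    and A_bound: "\<And>w. w \<in> cball 0 \<rho> \<Longrightarrow> norm (deriv (G e) w) \<le> M"
    and B_bound: "\<And>b w. b \<in> Basis \<Longrightarrow> w \<in> cball 0 \<rho> \<Longrightarrow> norm (deriv (G b) w / deriv (G e) w) \<le> M"
    and B'_bound: "\<And>b w. b \<in> Basis \<Longrightarrow> w \<in> cball 0 \<rho> \<Longrightarrow>
       norm (deriv (\<lambda>w. deriv (G b) w / deriv (G e) w) w) \<le> M"
begin

abbreviation "A b \<equiv> deriv (G b)"

definition B :: "'a \<Rightarrow> complex \<Rightarrow> complex" where "B b w = A b w / A e w"

text \<open>The equation \<open>\<phi> x t = t\<close> is \<open>g' t \<bullet> (x - t *\<^sub>R e) = 0\<close> divided by \<open>g' t \<bullet> e\<close>, as \<open>B e = 1\<close>.\<close>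
definition \<phi> :: "'a \<Rightarrow> complex \<Rightarrow> complex" where
  "\<phi> x w = (\<Sum>b\<in>Basis. of_real (x \<bullet> b) * B b w)"

definition \<phi>' :: "'a \<Rightarrow> complex \<Rightarrow> complex" where
  "\<phi>' x w = (\<Sum>b\<in>Basis. of_real (x \<bullet> b) * deriv (B b) w)"

definition g' :: "real \<Rightarrow> 'a" where
  "g' t = (\<Sum>b\<in>Basis. Re (A b (of_real t)) *\<^sub>R b)"

text \<open>The restriction of \<open>\<phi> x\<close> to the real axis. Its values are real for
  \<open>\<bar>t\<bar> < R\<close>, so \<open>Re\<close> discards nothing there.\<close>

definition \<beta> :: "'a \<Rightarrow> real \<Rightarrow> real" where
  "\<beta> x t = Re (\<phi> x (of_real t))"

lemma A_holo: "b \<in> Basis \<Longrightarrow> A b holomorphic_on ball 0 R"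
  by (intro holomorphic_deriv G_holo) auto

lemma B_holo: "b \<in> Basis \<Longrightarrow> B b holomorphic_on ball 0 R"
  unfolding B_def[abs_def] by (intro holomorphic_on_divide A_holo e_Basis A_nz)

lemma \<phi>_holo: "\<phi> x holomorphic_on ball 0 R"
  unfolding \<phi>_def[abs_def] by (intro holomorphic_intros B_holo)

lemma \<phi>_has_field_derivative:
  "w \<in> ball 0 R \<Longrightarrow> (\<phi> x has_field_derivative \<phi>' x w) (at w within S)"
  unfolding \<phi>_def[abs_def] \<phi>'_def
  by (intro DERIV_sum DERIV_cmult has_field_derivative_at_within[OF holomorphic_derivI[OF B_holo]]) auto

lemma cball_subset: "cball 0 \<rho> \<subseteq> ball (0::complex) R"
  using \<rho> by auto

lemma \<phi>_add: "\<phi> (x + y) w = \<phi> x w + \<phi> y w"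
  by (simp add: \<phi>_def inner_simps algebra_simps sum.distrib)

lemma \<phi>_scaleR: "\<phi> (s *\<^sub>R x) w = of_real s * \<phi> x w"
  by (simp add: \<phi>_def sum_distrib_left mult_ac)

lemma \<phi>_e: "w \<in> ball 0 R \<Longrightarrow> \<phi> e w = 1"
proof -
  assume "w \<in> ball 0 R"
  then have "B e w = 1" using A_nz by (simp add: B_def)
  moreover have "\<phi> e w = (\<Sum>b\<in>Basis. if b = e then B b w else 0)"
    unfolding \<phi>_def by (rule sum.cong) (use e_Basis in \<open>auto simp: inner_Basis\<close>)
  ultimately show ?thesis using e_Basis by simp
qed

section \<open>Contraction estimates and the root of the envelope equation\<close>

lemma sum_inner_bound:
  assumes "\<And>b. b \<in> Basis \<Longrightarrow> norm (f b :: complex) \<le> M"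
  shows "norm (\<Sum>b\<in>Basis. of_real (x \<bullet> b) * f b) \<le> real DIM('a) * M * norm (x::'a)"
proof -
  have "norm (\<Sum>b\<in>Basis. of_real (x \<bullet> b) * f b) \<le> (\<Sum>b\<in>(Basis::'a set). norm x * M)"
    using assms Basis_le_norm by (intro order_trans[OF norm_sum] sum_mono) (auto simp: norm_mult intro!: mult_mono)
  then show ?thesis by (simp add: mult_ac)
qed

lemma norm_\<phi>_le: "w \<in> cball 0 \<rho> \<Longrightarrow> norm (\<phi> x w) \<le> real DIM('a) * M * norm x"
  unfolding \<phi>_def B_def by (rule sum_inner_bound) (rule B_bound)

lemma norm_\<phi>'_le: "w \<in> cball 0 \<rho> \<Longrightarrow> norm (\<phi>' x w) \<le> real DIM('a) * M * norm x"
  unfolding \<phi>'_def B_def[abs_def] by (rule sum_inner_bound) (rule B'_bound)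

lemma DIM_M_le:
  assumes "norm (x::'a) \<le> r"
  shows "real DIM('a) * M * norm x \<le> \<rho> / 2" "real DIM('a) * M * norm x \<le> 1 / 2"
proof -
  have "real DIM('a) * M * norm x \<le> real DIM('a) * M * r"
    using assms M by (intro mult_left_mono) auto
  then show "real DIM('a) * M * norm x \<le> \<rho> / 2" "real DIM('a) * M * norm x \<le> 1 / 2"
    using order_trans r(2,3) by blast+
qed

text \<open>This serves twice: on real points it yields the fixed point, and on the disc it excludes
  further complex zeros of \<open>w - \<phi> x w\<close>.\<close>

lemma \<phi>_lipschitz:
  assumes "norm x \<le> r" "w \<in> cball 0 \<rho>" "w' \<in> cball 0 \<rho>"
  shows "norm (\<phi> x w - \<phi> x w') \<le> 1/2 * norm (w - w')"
proof (rule field_differentiable_bound[of "cball 0 \<rho>" "\<phi> x" "\<phi>' x"])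
  show "(\<phi> x has_field_derivative \<phi>' x z) (at z within cball 0 \<rho>)" if "z \<in> cball 0 \<rho>" for z
    using that cball_subset by (intro \<phi>_has_field_derivative) auto
  show "norm (\<phi>' x z) \<le> 1/2" if "z \<in> cball 0 \<rho>" for z
    using norm_\<phi>'_le[OF that, of x] DIM_M_le(2)[OF assms(1)] by linarith
qed (use assms in auto)

text \<open>On the real axis \<open>G b\<close> is real, so the derivative of its imaginary part,
  which is the imaginary part of \<open>A b\<close>, vanishes.\<close>

lemma g_deriv_components:
  assumes "b \<in> Basis" "\<bar>t\<bar> < R"
  shows "((\<lambda>t. g t \<bullet> b) has_vector_derivative Re (A b (of_real t))) (at t)"
    and "A b (of_real t) = of_real (Re (A b (of_real t)))"
proof -
  have "(G b has_field_derivative A b (of_real t)) (at (of_real t))"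
    using assms by (intro holomorphic_derivI[OF G_holo]) auto
  then have "((\<lambda>t. G b (of_real t)) has_vector_derivative A b (of_real t)) (at t)"
    by (rule has_vector_derivative_real_field)
  moreover have "\<forall>\<^sub>F s in nhds t. G b (of_real s) = of_real (g s \<bullet> b)"
    using eventually_nhds_in_open[of "ball 0 R" t] assms
    by (auto elim!: eventually_mono simp: G_real)
  ultimately have *: "((\<lambda>s. complex_of_real (g s \<bullet> b)) has_vector_derivative A b (of_real t)) (at t)"
    using assms by (subst (asm) has_vector_derivative_cong_ev[where g = "\<lambda>s. complex_of_real (g s \<bullet> b)"])
      (auto simp: G_real)
  from bounded_linear.has_vector_derivative[OF bounded_linear_Re *] show "((\<lambda>t. g t \<bullet> b) has_vector_derivative Re (A b (of_real t))) (at t)"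
    by simp
  have "((\<lambda>s. 0::real) has_vector_derivative Im (A b (of_real t))) (at t)"
    using bounded_linear.has_vector_derivative[OF bounded_linear_Im *] by simp
  then have "Im (A b (of_real t)) = 0"
    using vector_derivative_unique_at has_vector_derivative_const by blast
  then show "A b (of_real t) = of_real (Re (A b (of_real t)))"
    by (simp add: complex_eq_iff)
qed

lemma g'_component: "b \<in> Basis \<Longrightarrow> g' t \<bullet> b = Re (A b (of_real t))"
  by (simp add: g'_def inner_sum_left inner_Basis if_distrib cong: if_cong)

lemma A_of_real: "b \<in> Basis \<Longrightarrow> \<bar>t\<bar> < R \<Longrightarrow> A b (of_real t) = of_real (g' t \<bullet> b)"
  using g_deriv_components(2)[of b t] g'_component[of b t] by simp

lemma g_has_vector_derivative:
  assumes "\<bar>t\<bar> < R" shows "(g has_vector_derivative g' t) (at t)"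
  using g_deriv_components(1)[OF _ assms] g'_component
  unfolding has_vector_derivative_def
  by (subst has_derivative_componentwise_within) simp

lemma g'_e_nz: "\<bar>t\<bar> < R \<Longrightarrow> g' t \<bullet> e \<noteq> 0"
  using A_nz[of "of_real t"] A_of_real[OF e_Basis, of t] by auto

lemma \<beta>_eq:
  assumes "\<bar>t\<bar> < R"
  shows "\<phi> x (of_real t) = of_real (\<beta> x t)" and "(g' t \<bullet> e) * \<beta> x t = g' t \<bullet> x"
proof -
  have *: "\<phi> x (of_real t) = of_real ((\<Sum>b\<in>Basis. (x \<bullet> b) * (g' t \<bullet> b)) / (g' t \<bullet> e))"
    using assms e_Basis by (simp add: \<phi>_def B_def A_of_real sum_divide_distrib)
  also have "(\<Sum>b\<in>Basis. (x \<bullet> b) * (g' t \<bullet> b)) = g' t \<bullet> x"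
    by (subst euclidean_inner) (simp add: mult_ac)
  finally have **: "\<phi> x (of_real t) = of_real ((g' t \<bullet> x) / (g' t \<bullet> e))" .
  then show "\<phi> x (of_real t) = of_real (\<beta> x t)" by (simp add: \<beta>_def)
  show "(g' t \<bullet> e) * \<beta> x t = g' t \<bullet> x"
    using g'_e_nz[OF assms] by (simp add: \<beta>_def **)
qed

lemma \<beta>_lipschitz:
  assumes "norm x \<le> r" "\<bar>t\<bar> \<le> \<rho>" "\<bar>t'\<bar> \<le> \<rho>"
  shows "\<bar>\<beta> x t - \<beta> x t'\<bar> \<le> 1/2 * \<bar>t - t'\<bar>"
proof -
  have "\<bar>\<beta> x t - \<beta> x t'\<bar> \<le> norm (\<phi> x (of_real t) - \<phi> x (of_real t'))"
    unfolding \<beta>_def using abs_Re_le_cmod[of "\<phi> x (of_real t) - \<phi> x (of_real t')"] by simp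
  also have "\<dots> \<le> 1/2 * norm (complex_of_real t - of_real t')"
    using assms by (intro \<phi>_lipschitz) auto
  also have "norm (complex_of_real t - of_real t') = \<bar>t - t'\<bar>"
    by (metis norm_of_real of_real_diff)
  finally show ?thesis .
qed

lemma abs_\<beta>_le: "\<bar>t\<bar> \<le> \<rho> \<Longrightarrow> \<bar>\<beta> x t\<bar> \<le> real DIM('a) * M * norm x"
  unfolding \<beta>_def using norm_\<phi>_le[of "of_real t" x] abs_Re_le_cmod[of "\<phi> x (of_real t)"] by simp

lemma ex1_root:
  assumes "norm x \<le> r"
  shows "\<exists>!t. t \<in> {-\<rho>..\<rho>} \<and> \<beta> x t = t"
proof (rule Banach_fix[where c = "1/2"])
  show "\<beta> x ` {-\<rho>..\<rho>} \<subseteq> {-\<rho>..\<rho>}"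
  proof clarify
    fix t assume "t \<in> {-\<rho>..\<rho>}"
    then have "\<bar>t\<bar> \<le> \<rho>" by auto
    then have "\<bar>\<beta> x t\<bar> \<le> \<rho> / 2" using order_trans[OF abs_\<beta>_le DIM_M_le(1)[OF assms]] by blast
    then show "\<beta> x t \<in> {-\<rho>..\<rho>}" using \<rho> by auto
  qed
  show "dist (\<beta> x t) (\<beta> x t') \<le> 1/2 * dist t t'" if "t \<in> {-\<rho>..\<rho>}" "t' \<in> {-\<rho>..\<rho>}" for t t'
    unfolding dist_real_def using that by (intro \<beta>_lipschitz assms) auto
qed (use \<rho> in \<open>auto simp: compact_imp_complete\<close>)

definition \<tau> :: "'a \<Rightarrow> real" where
  "\<tau> x = (THE t. t \<in> {-\<rho>..\<rho>} \<and> \<beta> x t = t)"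

lemma \<tau>_root: "norm x \<le> r \<Longrightarrow> \<beta> x (\<tau> x) = \<tau> x" "norm x \<le> r \<Longrightarrow> \<bar>\<tau> x\<bar> \<le> \<rho>"
  using theI'[OF ex1_root[of x]] unfolding \<tau>_def by auto

lemma \<tau>_unique: "norm x \<le> r \<Longrightarrow> \<bar>t\<bar> \<le> \<rho> \<Longrightarrow> \<beta> x t = t \<Longrightarrow> \<tau> x = t"
  unfolding \<tau>_def by (rule the1_equality[OF ex1_root]) auto

lemma abs_\<tau>_le: "norm x \<le> r \<Longrightarrow> \<bar>\<tau> x\<bar> \<le> real DIM('a) * M * norm x"
  using \<tau>_root[of x] abs_\<beta>_le[of "\<tau> x" x] by simp

text \<open>The root even lies within \<open>\<rho> / 2\<close>, hence strictly inside the circle of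
  radius \<open>\<rho>\<close>, as Cauchy's formula and the derivative of \<open>H\<close>
  require.\<close>

lemma \<tau>_less:
  assumes "norm x \<le> r" shows "\<bar>\<tau> x\<bar> < \<rho>" "\<bar>\<tau> x\<bar> < R"
  using abs_\<tau>_le[OF assms] DIM_M_le(1)[OF assms] \<rho> by auto

lemma \<tau>_orthogonal:
  assumes "norm x \<le> r"
  shows "g' (\<tau> x) \<bullet> (x - \<tau> x *\<^sub>R e) = 0"
  using \<beta>_eq(2)[OF \<tau>_less(2)[OF assms], of x] \<tau>_root(1)[OF assms] by (simp add: inner_simps mult.commute)

lemma \<tau>_of_orthogonal:
  assumes "norm x \<le> r" "\<bar>t\<bar> \<le> \<rho>" "g' t \<bullet> (x - t *\<^sub>R e) = 0"
  shows "\<tau> x = t"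
proof (rule \<tau>_unique)
  have t: "\<bar>t\<bar> < R" using assms \<rho> by simp
  have "(g' t \<bullet> e) * \<beta> x t = (g' t \<bullet> e) * t"
    using \<beta>_eq(2)[OF t, of x] assms(3) by (simp add: inner_simps)
  then show "\<beta> x t = t" using g'_e_nz[OF t] by simp
qed (use assms in auto)

lemma \<tau>_axis: "\<bar>t\<bar> \<le> r \<Longrightarrow> \<bar>t\<bar> \<le> \<rho> \<Longrightarrow> \<tau> (t *\<^sub>R e) = t"
  using e_Basis by (intro \<tau>_of_orthogonal) auto

end

text \<open>The factor \<open>(y - x) \<bullet> b\<close> vanishes at \<open>x\<close>, so
  continuity of \<open>c\<close> suffices. This is used for the coefficients in the increment of
  \<open>\<tau>\<close>.\<close>

lemma has_derivative_inner_mult_continuous: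
  fixes x :: "'a::euclidean_space" and c :: "'a \<Rightarrow> real"
  assumes "isCont c x"
  shows "((\<lambda>y. ((y - x) \<bullet> b) * c y) has_derivative (\<lambda>h. (h \<bullet> b) * c x)) (at x)"
  unfolding has_derivative_iff_norm
proof
  show "bounded_linear (\<lambda>h. h \<bullet> b * c x)" by (intro bounded_linear_intros)
  have *: "((\<lambda>y. \<bar>c y - c x\<bar> * norm b) \<longlongrightarrow> 0) (at x)"
    using assms unfolding isCont_def by (auto intro!: tendsto_eq_intros)
  show "((\<lambda>y. norm ((y - x) \<bullet> b * c y - (x - x) \<bullet> b * c x - (y - x) \<bullet> b * c x) / norm (y - x)) \<longlongrightarrow> 0) (at x)"
  proof (rule Lim_null_comparison[OF _ *], rule always_eventually, rule allI)
    fix y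
    have "norm ((y - x) \<bullet> b * c y - (x - x) \<bullet> b * c x - (y - x) \<bullet> b * c x) = \<bar>(y - x) \<bullet> b\<bar> * \<bar>c y - c x\<bar>"
      by (simp add: abs_mult[symmetric] algebra_simps)
    also have "\<dots> \<le> (norm (y - x) * norm b) * \<bar>c y - c x\<bar>"
      by (intro mult_right_mono Cauchy_Schwarz_ineq2) auto
    finally show "norm (norm ((y - x) \<bullet> b * c y - (x - x) \<bullet> b * c x - (y - x) \<bullet> b * c x) / norm (y - x)) \<le> \<bar>c y - c x\<bar> * norm b"
      by (cases "y = x") (auto simp: field_simps)
  qed
qed

section \<open>Differentiating the root\<close>

context gauss_curve
begin

definition \<beta>' :: "'a \<Rightarrow> real \<Rightarrow> real" where
  "\<beta>' x t = Re (\<phi>' x (of_real t))"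

lemma
  assumes "\<bar>t\<bar> < R"
  shows \<beta>_has_derivative: "(\<beta> x has_real_derivative \<beta>' x t) (at t)"
    and \<phi>'_of_real: "\<phi>' x (of_real t) = of_real (\<beta>' x t)"
proof -
  have "(\<phi> x has_field_derivative \<phi>' x (of_real t)) (at (of_real t))"
    using assms by (intro \<phi>_has_field_derivative) auto
  then have "((\<lambda>t. \<phi> x (of_real t)) has_vector_derivative \<phi>' x (of_real t)) (at t)"
    by (rule has_vector_derivative_real_field)
  moreover have "\<forall>\<^sub>F s in nhds t. \<phi> x (of_real s) = of_real (\<beta> x s)"
    using eventually_nhds_in_open[of "ball 0 R" t] assms
    by (auto elim!: eventually_mono simp: \<beta>_eq)
  ultimately have *: "((\<lambda>s. complex_of_real (\<beta> x s)) has_vector_derivative \<phi>' x (of_real t)) (at t)"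
    using assms by (subst (asm) has_vector_derivative_cong_ev[where g = "\<lambda>s. complex_of_real (\<beta> x s)"])
      (auto simp: \<beta>_eq)
  from bounded_linear.has_vector_derivative[OF bounded_linear_Re *]
  show "(\<beta> x has_real_derivative \<beta>' x t) (at t)"
    by (simp add: has_real_derivative_iff_has_vector_derivative \<beta>'_def)
  have "((\<lambda>s. 0::real) has_vector_derivative Im (\<phi>' x (of_real t))) (at t)"
    using bounded_linear.has_vector_derivative[OF bounded_linear_Im *] by simp
  then have "Im (\<phi>' x (of_real t)) = 0"
    using vector_derivative_unique_at has_vector_derivative_const by blast
  then show "\<phi>' x (of_real t) = of_real (\<beta>' x t)"
    by (simp add: complex_eq_iff \<beta>'_def)
qed

lemma \<beta>'_le: "norm x \<le> r \<Longrightarrow> \<bar>t\<bar> \<le> \<rho> \<Longrightarrow> \<bar>\<beta>' x t\<bar> \<le> 1/2"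
  unfolding \<beta>'_def
  using order_trans[OF order_trans[OF abs_Re_le_cmod norm_\<phi>'_le] DIM_M_le(2), of "of_real t" x] by simp

lemma \<beta>_diff: "\<beta> (x - y) t = \<beta> x t - \<beta> y t"
  using \<phi>_add[of "x - y" y "of_real t"] by (simp add: \<beta>_def)

lemma \<beta>_sum: "\<beta> x t = (\<Sum>b\<in>Basis. (x \<bullet> b) * \<beta> b t)"
proof -
  have "\<phi> b w = B b w" if "b \<in> Basis" for b w
  proof -
    have "\<phi> b w = (\<Sum>c\<in>Basis. if c = b then B c w else 0)"
      unfolding \<phi>_def by (rule sum.cong) (use that in \<open>auto simp: inner_Basis\<close>)
    then show ?thesis using that by simp
  qed
  then show ?thesis by (simp add: \<beta>_def) (simp add: \<phi>_def)
qed

text \<open>Split the change of the fixed point: the change of \<open>t\<close> contributes at most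
  half of the left side and is absorbed there; the change of the parameter contributes the
  rest.\<close>

lemma \<tau>_lipschitz:
  assumes "norm x \<le> r" "norm y \<le> r"
  shows "\<bar>\<tau> x - \<tau> y\<bar> \<le> 2 * (real DIM('a) * M * norm (x - y))"
proof -
  have "\<tau> x - \<tau> y = (\<beta> x (\<tau> x) - \<beta> x (\<tau> y)) + \<beta> (x - y) (\<tau> y)"
    using assms by (simp add: \<tau>_root \<beta>_diff)
  then have "\<bar>\<tau> x - \<tau> y\<bar> \<le> \<bar>\<beta> x (\<tau> x) - \<beta> x (\<tau> y)\<bar> + \<bar>\<beta> (x - y) (\<tau> y)\<bar>"
    by (metis abs_triangle_ineq)
  moreover have "\<bar>\<beta> x (\<tau> x) - \<beta> x (\<tau> y)\<bar> \<le> 1/2 * \<bar>\<tau> x - \<tau> y\<bar>"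
    using assms by (intro \<beta>_lipschitz \<tau>_root) auto
  moreover have "\<bar>\<beta> (x - y) (\<tau> y)\<bar> \<le> real DIM('a) * M * norm (x - y)"
    using assms by (intro abs_\<beta>_le \<tau>_root)
  ultimately have "\<bar>\<tau> x - \<tau> y\<bar> \<le> 1/2 * \<bar>\<tau> x - \<tau> y\<bar> + real DIM('a) * M * norm (x - y)"
    by (meson add_mono order_trans)
  then show ?thesis by argo
qed

lemma isCont_\<tau>:
  assumes "norm x < r" shows "isCont \<tau> x"
proof -
  have "continuous_on (ball 0 r) \<tau>"
  proof (rule lipschitz_on_continuous_on)
    show "(2 * (real DIM('a) * M))-lipschitz_on (ball 0 r) \<tau>"
      using M by (intro lipschitz_onI) (auto simp: dist_real_def dist_norm mult.assoc intro!: \<tau>_lipschitz[simplified mult.assoc])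
  qed
  then show ?thesis using assms by (simp add: continuous_on_eq_continuous_at)
qed

text \<open>Subtracting the root equations at \<open>y\<close> and \<open>x\<close> and solving for
  \<open>\<tau> y - \<tau> x\<close> gives a sum of coordinates of \<open>y - x\<close> times
  coefficients continuous at \<open>x\<close>.\<close>

lemma \<tau>_has_derivative:
  assumes "norm x < r"
  shows "(\<tau> has_derivative (\<lambda>h. \<beta> h (\<tau> x) / (1 - \<beta>' x (\<tau> x)))) (at x)"
proof -
  define t where "t = \<tau> x"
  have t: "\<bar>t\<bar> < \<rho>" "\<bar>t\<bar> < R" "\<beta> x t = t" using \<tau>_less[of x] \<tau>_root[of x] assms by (auto simp: t_def)
  \<comment> \<open>Caratheodory's form of the derivative makes the implicit differentiation purely algebraic\<close>
  obtain \<theta> where \<theta>: "\<And>z. \<beta> x z - \<beta> x t = \<theta> z * (z - t)" "isCont \<theta> t" "\<theta> t = \<beta>' x t"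
    using \<beta>_has_derivative[OF t(2), of x] unfolding CARAT_DERIV by blast
  \<comment> \<open>Keeps the denominator \<open>1 - \<theta> (\<tau> y)\<close> away from
    zero.\<close>
  have \<theta>_le: "\<bar>\<theta> z\<bar> \<le> 1/2" if "\<bar>z\<bar> \<le> \<rho>" for z
  proof (cases "z = t")
    case True
    then show ?thesis using \<theta>(3) \<beta>'_le[of x t] assms t by simp
  next
    case False
    have "\<bar>\<theta> z\<bar> * \<bar>z - t\<bar> \<le> 1/2 * \<bar>z - t\<bar>"
      using \<beta>_lipschitz[of x z t] \<theta>(1)[of z] assms that t by (simp add: abs_mult)
    then show ?thesis using False by simp
  qed
  define c where "c b y = \<beta> b (\<tau> y) / (1 - \<theta> (\<tau> y))" for b y
  have "isCont (c b) x" for b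
  proof -
    have 1: "isCont (\<lambda>y. \<beta> b (\<tau> y)) x"
      using isCont_o2[OF isCont_\<tau>[OF assms], of "\<beta> b"] DERIV_isCont[OF \<beta>_has_derivative[OF t(2)]]
      by (simp add: t_def)
    have 2: "isCont (\<lambda>y. \<theta> (\<tau> y)) x"
      using isCont_o2[OF isCont_\<tau>[OF assms], of \<theta>] \<theta>(2) by (simp add: t_def)
    show ?thesis unfolding c_def[abs_def]
      by (intro continuous_intros 1 2) (use \<theta>_le[of t] t in \<open>auto simp: t_def\<close>)
  qed
  then have "((\<lambda>y. t + (\<Sum>b\<in>Basis. ((y - x) \<bullet> b) * c b y)) has_derivative (\<lambda>h. 0 + (\<Sum>b\<in>Basis. (h \<bullet> b) * c b x))) (at x)"
    by (intro has_derivative_add has_derivative_const has_derivative_sum has_derivative_inner_mult_continuous)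
  moreover have "t + (\<Sum>b\<in>Basis. ((y - x) \<bullet> b) * c b y) = \<tau> y" if "y \<in> ball 0 r" for y
  proof -
    have y: "norm y \<le> r" using that by simp
    have "\<bar>\<theta> (\<tau> y)\<bar> \<le> 1/2" using \<theta>_le \<tau>_root(2)[OF y] by blast
    then have nz: "1 - \<theta> (\<tau> y) \<noteq> 0" by auto
    have "\<tau> y - t = \<beta> (y - x) (\<tau> y) + \<theta> (\<tau> y) * (\<tau> y - t)"
      using \<theta>(1)[of "\<tau> y"] t(3) \<tau>_root(1)[OF y] by (simp add: \<beta>_diff)
    then have "(\<tau> y - t) * (1 - \<theta> (\<tau> y)) = \<beta> (y - x) (\<tau> y)" by (simp add: algebra_simps)
    moreover have "(\<Sum>b\<in>Basis. ((y - x) \<bullet> b) * c b y) = \<beta> (y - x) (\<tau> y) / (1 - \<theta> (\<tau> y))"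
      unfolding c_def by (subst \<beta>_sum) (simp add: sum_divide_distrib)
    ultimately have "(\<Sum>b\<in>Basis. ((y - x) \<bullet> b) * c b y) = \<tau> y - t"
      using nz by (metis nonzero_mult_div_cancel_right)
    then show ?thesis by simp
  qed
  moreover have "0 + (\<Sum>b\<in>Basis. (h \<bullet> b) * c b x) = \<beta> h (\<tau> x) / (1 - \<beta>' x (\<tau> x))" for h
    using \<theta>(3) unfolding c_def by (subst (2) \<beta>_sum) (simp add: sum_divide_distrib t_def)
  ultimately show ?thesis
    using has_derivative_transform_within_open[of _ _ x UNIV "ball 0 r" \<tau>] assms by simp
qed

lemma one_minus_\<beta>'_pos: "norm x \<le> r \<Longrightarrow> 1 - \<beta>' x (\<tau> x) > 0"
  using \<beta>'_le[of x "\<tau> x"] \<tau>_root(2)[of x] by auto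

text \<open>The oriented integral of \<open>g \<bullet> e\<close> from 0 to \<open>t\<close>,
  written as a difference so that negative \<open>t\<close> are covered as well.\<close>

definition H :: "real \<Rightarrow> real" where
  "H t = integral {-\<rho>..t} (\<lambda>s. g s \<bullet> e) - integral {-\<rho>..0} (\<lambda>s. g s \<bullet> e)"

lemma H_has_derivative:
  assumes "\<bar>t\<bar> < \<rho>" shows "(H has_real_derivative g t \<bullet> e) (at t)"
proof -
  have "continuous_on {-\<rho>..\<rho>} g"
    using \<rho> by (intro continuous_at_imp_continuous_on ballI)
      (auto intro!: has_vector_derivative_continuous[OF g_has_vector_derivative])
  then have "((\<lambda>t. integral {-\<rho>..t} (\<lambda>s. g s \<bullet> e)) has_real_derivative g t \<bullet> e) (at t within {-\<rho>..\<rho>})"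
    using assms by (intro integral_has_real_derivative continuous_intros) auto
  then have "((\<lambda>t. integral {-\<rho>..t} (\<lambda>s. g s \<bullet> e)) has_real_derivative g t \<bullet> e) (at t)"
    using assms by (subst (asm) at_within_interior) auto
  then show ?thesis unfolding H_def[abs_def] by (auto intro!: derivative_eq_intros)
qed

section \<open>The envelope function and its derivatives\<close>

definition u :: "'a \<Rightarrow> real" where
  "u x = g (\<tau> x) \<bullet> (x - \<tau> x *\<^sub>R e) + H (\<tau> x)"

lemma g_\<tau>_has_derivative:
  assumes "norm x < r"
  shows "((\<lambda>y. g (\<tau> y)) has_derivative (\<lambda>h. (\<beta> h (\<tau> x) / (1 - \<beta>' x (\<tau> x))) *\<^sub>R g' (\<tau> x))) (at x)"
  using has_derivative_compose[OF \<tau>_has_derivative[OF assms]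
      g_has_vector_derivative[unfolded has_vector_derivative_def]] \<tau>_less(2)[of x] assms by simp

text \<open>Envelope cancellation: of the terms containing the derivative of \<open>\<tau>\<close>,
  the one from \<open>H\<close> cancels the one from \<open>- \<tau> x *\<^sub>R e\<close>, and the
  one with \<open>g'\<close> vanishes by \<open>\<tau>_orthogonal\<close>.\<close>

lemma u_has_derivative:
  assumes "norm x < r"
  shows "(u has_derivative (\<lambda>h. g (\<tau> x) \<bullet> h)) (at x)"
proof -
  define d where "d h = \<beta> h (\<tau> x) / (1 - \<beta>' x (\<tau> x))" for h
  have d: "(\<tau> has_derivative d) (at x)" unfolding d_def[abs_def] by (rule \<tau>_has_derivative[OF assms])
  have gd: "((\<lambda>y. g (\<tau> y)) has_derivative (\<lambda>h. d h *\<^sub>R g' (\<tau> x))) (at x)"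
    unfolding d_def[abs_def] by (rule g_\<tau>_has_derivative[OF assms])
  have Hd: "((\<lambda>y. H (\<tau> y)) has_derivative (\<lambda>h. (g (\<tau> x) \<bullet> e) * d h)) (at x)"
    using has_derivative_compose[OF d H_has_derivative[unfolded has_field_derivative_def]] \<tau>_less(1)[of x] assms by simp
  show ?thesis
    unfolding u_def[abs_def]
  proof (rule has_derivative_eq_rhs)
    show "((\<lambda>x. g (\<tau> x) \<bullet> (x - \<tau> x *\<^sub>R e) + H (\<tau> x)) has_derivative
       (\<lambda>h. (g (\<tau> x) \<bullet> (h - d h *\<^sub>R e) + (d h *\<^sub>R g' (\<tau> x)) \<bullet> (x - \<tau> x *\<^sub>R e)) + (g (\<tau> x) \<bullet> e) * d h)) (at x)"
      by (intro has_derivative_add has_derivative_inner has_derivative_diff has_derivative_ident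
          has_derivative_scaleR_left gd Hd d)
    show "(\<lambda>h. (g (\<tau> x) \<bullet> (h - d h *\<^sub>R e) + (d h *\<^sub>R g' (\<tau> x)) \<bullet> (x - \<tau> x *\<^sub>R e)) + (g (\<tau> x) \<bullet> e) * d h)
       = (\<lambda>h. g (\<tau> x) \<bullet> h)"
      using \<tau>_orthogonal[of x] assms by (auto simp: inner_diff_right)
  qed
qed

text \<open>The second derivative of \<open>u\<close> at \<open>x\<close> in direction \<open>y\<close>.\<close>
definition curv :: "'a \<Rightarrow> 'a \<Rightarrow> real" where
  "curv x y = (g' (\<tau> x) \<bullet> e) * (\<beta> y (\<tau> x))\<^sup>2 / (1 - \<beta>' x (\<tau> x))"

lemma u_line_derivatives:
  assumes "norm (x + s *\<^sub>R y) < r"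
  shows "((\<lambda>s. u (x + s *\<^sub>R y)) has_real_derivative g (\<tau> (x + s *\<^sub>R y)) \<bullet> y) (at s)"
    and "((\<lambda>s. g (\<tau> (x + s *\<^sub>R y)) \<bullet> y) has_real_derivative curv (x + s *\<^sub>R y) y) (at s)"
proof -
  have line: "((\<lambda>s. x + s *\<^sub>R y) has_derivative (\<lambda>h. h *\<^sub>R y)) (at s)"
    by (auto intro!: derivative_eq_intros)
  show "((\<lambda>s. u (x + s *\<^sub>R y)) has_real_derivative g (\<tau> (x + s *\<^sub>R y)) \<bullet> y) (at s)"
    using has_derivative_compose[OF line u_has_derivative[OF assms]]
    by (simp add: has_field_derivative_def mult.commute[of _ "g _ \<bullet> _"])
  define z where "z = x + s *\<^sub>R y"
  have \<beta>s: "\<beta> (h *\<^sub>R y) t = h * \<beta> y t" for h t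
    by (simp add: \<beta>_def \<phi>_scaleR)
  have "((\<lambda>s. g (\<tau> (x + s *\<^sub>R y)) \<bullet> y) has_derivative
      (\<lambda>h. ((\<beta> (h *\<^sub>R y) (\<tau> z) / (1 - \<beta>' z (\<tau> z))) *\<^sub>R g' (\<tau> z)) \<bullet> y)) (at s)"
    using has_derivative_compose[OF line g_\<tau>_has_derivative[OF assms]]
    unfolding z_def by (rule has_derivative_inner_left)
  \<comment> \<open>The identity \<open>g' t \<bullet> y = (g' t \<bullet> e) * \<beta> y t\<close>
    at the root produces the square in \<open>curv\<close>.\<close>
  moreover have "((\<beta> (h *\<^sub>R y) (\<tau> z) / (1 - \<beta>' z (\<tau> z))) *\<^sub>R g' (\<tau> z)) \<bullet> y = curv z y * h" for h
    using \<beta>_eq(2)[OF \<tau>_less(2), of z y] assms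
    by (simp add: curv_def \<beta>s z_def power2_eq_square mult_ac)
  ultimately show "((\<lambda>s. g (\<tau> (x + s *\<^sub>R y)) \<bullet> y) has_real_derivative curv (x + s *\<^sub>R y) y) (at s)"
    by (simp add: has_field_derivative_def z_def)
qed

end

section \<open>Analyticity of the envelope\<close>

text \<open>The mean value inequality applied twice. It carries a remainder bound for the second
  derivative over to the function itself.\<close>

lemma second_order_bound:
  fixes U U' U'' :: "real \<Rightarrow> real"
  assumes U: "\<And>s. s \<in> {0..1} \<Longrightarrow> (U has_real_derivative U' s) (at s)"
    and U': "\<And>s. s \<in> {0..1} \<Longrightarrow> (U' has_real_derivative U'' s) (at s)"
    and U'': "\<And>s. s \<in> {0..1} \<Longrightarrow> \<bar>U'' s\<bar> \<le> \<delta>"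
    and 0: "U 0 = 0" "U' 0 = 0"
  shows "\<bar>U 1\<bar> \<le> \<delta>"
proof -
  have "0 \<le> \<delta>" using U''[of 0] by auto
  have *: "\<bar>U' s\<bar> \<le> \<delta>" if s: "s \<in> {0..1}" for s
  proof -
    have "norm (U' s - U' 0) \<le> \<delta> * norm (s - 0)"
      by (rule field_differentiable_bound[of "{0..1}" U' U''])
         (use s U' U'' in \<open>auto intro: has_field_derivative_at_within\<close>)
    also have "\<dots> \<le> \<delta> * 1" using s \<open>0 \<le> \<delta>\<close> by (intro mult_left_mono) auto
    finally show ?thesis by (simp add: 0)
  qed
  have "norm (U 1 - U 0) \<le> \<delta> * norm (1 - 0 :: real)"
    by (rule field_differentiable_bound[of "{0..1}" U U'])
       (use U * in \<open>auto intro: has_field_derivative_at_within\<close>)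
  then show ?thesis by (simp add: 0)
qed

lemma geometric_remainder:
  fixes L p :: complex
  assumes "L \<noteq> 0" "L - p \<noteq> 0"
  shows "1 / (L - p) - (\<Sum>m<N. p ^ m / L ^ Suc m) = p ^ N / (L ^ N * (L - p))"
  using assms
proof (induction N)
  case (Suc N)
  then have "1 / (L - p) - (\<Sum>m<Suc N. p ^ m / L ^ Suc m) = p ^ N / (L ^ N * (L - p)) - p ^ N / L ^ Suc N"
    by (simp add: algebra_simps)
  also have "\<dots> = p ^ Suc N / (L ^ Suc N * (L - p))"
    using assms by (simp add: divide_simps) (simp add: algebra_simps)
  finally show ?case .
qed simp

section \<open>Contour integrals for the second derivative and their expansion\<close>

context gauss_curve
begin

text \<open>On the circle \<open>\<phi> x w\<close> is at most half as large as \<open>w\<close>,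
  which keeps the integrands away from their poles uniformly in \<open>x\<close>.\<close>

lemma denominator_lower_bound:
  assumes "norm x \<le> r" "norm w = \<rho>"
  shows "\<rho> / 2 \<le> norm (w - \<phi> x w)" "w - \<phi> x w \<noteq> 0"
proof -
  have "norm (\<phi> x w) \<le> \<rho> / 2"
    using order_trans[OF norm_\<phi>_le DIM_M_le(1)[OF assms(1)]] assms(2) by simp
  then show *: "\<rho> / 2 \<le> norm (w - \<phi> x w)"
    using norm_triangle_ineq2[of w "\<phi> x w"] assms(2) by linarith
  show "w - \<phi> x w \<noteq> 0" using * \<rho> by auto
qed

text \<open>A residue computation: the only zero of \<open>w - \<phi> x w\<close> in the disc is the
  simple zero \<open>\<tau> x\<close>, where the derivative is
  \<open>1 - \<beta>' x (\<tau> x)\<close>.\<close>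

lemma curv_contour_integral:
  assumes "norm x \<le> r"
  shows "((\<lambda>w. A e w * (\<phi> y w)\<^sup>2 / (w - \<phi> x w)) has_contour_integral (2 * of_real pi * \<i> * of_real (curv x y))) (circlepath 0 \<rho>)"
proof -
  define t where "t = complex_of_real (\<tau> x)"
  have t: "norm t < \<rho>" "t \<in> cball 0 \<rho>" "t \<in> ball 0 R"
    using \<tau>_less[OF assms] by (auto simp: t_def)
  have \<phi>t: "\<phi> x t = t"
    using \<beta>_eq(1)[OF \<tau>_less(2)[OF assms], of x] \<tau>_root(1)[OF assms] by (simp add: t_def)
  define f where "f w = w - \<phi> x w" for w
  have f_holo: "f holomorphic_on ball 0 R"
    unfolding f_def[abs_def] by (intro holomorphic_intros \<phi>_holo)
  have f_deriv: "deriv f t = 1 - \<phi>' x t"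
    unfolding f_def[abs_def]
    by (intro DERIV_imp_deriv DERIV_diff DERIV_ident \<phi>_has_field_derivative t)
  have f_nz: "f w \<noteq> 0" if "w \<in> cball 0 \<rho>" "w \<noteq> t" for w
  proof
    assume "f w = 0"
    then have "norm (w - t) \<le> 1/2 * norm (w - t)"
      using \<phi>_lipschitz[OF assms that(1) t(2)] by (simp add: f_def \<phi>t)
    then show False using that(2) by simp
  qed
  \<comment> \<open>\<open>f w = E w * (w - t)\<close> with \<open>E\<close> zero-free on the disc, so Cauchy's formula applies to \<open>k / (w - t)\<close>\<close>
  define E where "E w = (if w = t then deriv f t else (f w - f t) / (w - t))" for w
  have E_holo: "E holomorphic_on ball 0 R"
    unfolding E_def[abs_def] by (rule pole_lemma_open[OF f_holo open_ball])
  have Et: "E t = of_real (1 - \<beta>' x (\<tau> x))"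
    using \<phi>'_of_real[OF \<tau>_less(2)[OF assms], of x, folded t_def] by (simp add: E_def f_deriv)
  have E_nz: "E w \<noteq> 0" if "w \<in> cball 0 \<rho>" for w
  proof (cases "w = t")
    case True
    then show ?thesis using Et one_minus_\<beta>'_pos[OF assms] by (simp del: of_real_diff)
  next
    case False
    then show ?thesis using f_nz[OF that False] by (simp add: E_def f_def \<phi>t)
  qed
  define k where "k w = A e w * (\<phi> y w)\<^sup>2 / E w" for w
  have "k holomorphic_on cball 0 \<rho>"
    unfolding k_def[abs_def]
    by (intro holomorphic_on_divide holomorphic_on_mult holomorphic_on_power E_nz)
       (auto intro: holomorphic_on_subset[OF A_holo[OF e_Basis] cball_subset]
          holomorphic_on_subset[OF \<phi>_holo cball_subset] holomorphic_on_subset[OF E_holo cball_subset])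
  then have "((\<lambda>w. k w / (w - t)) has_contour_integral (2 * of_real pi * \<i> * k t)) (circlepath 0 \<rho>)"
    using t(1) by (intro Cauchy_integral_circlepath)
      (auto intro: holomorphic_on_imp_continuous_on holomorphic_on_subset)
  moreover have "k t = of_real (curv x y)"
    using A_of_real[OF e_Basis \<tau>_less(2)[OF assms]] \<beta>_eq(1)[OF \<tau>_less(2)[OF assms], of y]
    by (simp add: k_def Et curv_def) (simp add: t_def)
  ultimately have "((\<lambda>w. k w / (w - t)) has_contour_integral (2 * of_real pi * \<i> * of_real (curv x y))) (circlepath 0 \<rho>)"
    by simp
  then show ?thesis
  proof (rule has_contour_integral_eq)
    fix w assume "w \<in> path_image (circlepath 0 \<rho>)"
    then have w: "norm w = \<rho>" "w \<noteq> t" using \<rho> t by auto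
    then have "E w * (w - t) = f w" by (simp add: E_def f_def \<phi>t)
    then show "k w / (w - t) = A e w * (\<phi> y w)\<^sup>2 / (w - \<phi> x w)"
      by (simp add: k_def f_def)
  qed
qed

lemma circle_holo_contour_integrable:
  assumes "\<And>w. norm w = \<rho> \<Longrightarrow> q w \<noteq> 0" "p holomorphic_on ball 0 R" "q holomorphic_on ball 0 R"
  shows "(\<lambda>w. p w / q w) contour_integrable_on (circlepath 0 \<rho>)"
proof -
  have "sphere 0 \<rho> \<subseteq> ball (0::complex) R" using \<rho> by auto
  then have "continuous_on (path_image (circlepath 0 \<rho>)) (\<lambda>w. p w / q w)"
    using assms \<rho> by (auto intro!: continuous_on_divide intro: holomorphic_on_imp_continuous_on continuous_on_subset)
  then show ?thesis by (rule contour_integrable_continuous_circlepath)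
qed

text \<open>With \<open>p\<close> a power of \<open>\<phi> y\<close>, these are the coefficients
  obtained by expanding the integral for \<open>curv (x + s *\<^sub>R y) y\<close> in powers of
  \<open>s\<close>.\<close>

definition coef :: "'a \<Rightarrow> (complex \<Rightarrow> complex) \<Rightarrow> nat \<Rightarrow> complex" where
  "coef x p n = contour_integral (circlepath 0 \<rho>) (\<lambda>w. A e w * p w / (w - \<phi> x w) ^ n) / (2 * of_real pi * \<i>)"

lemma coef_integrable:
  assumes "norm x \<le> r" "p holomorphic_on ball 0 R"
  shows "(\<lambda>w. A e w * p w / (w - \<phi> x w) ^ n) contour_integrable_on (circlepath 0 \<rho>)"
  using denominator_lower_bound(2)[OF assms(1)] assms(2)
  by (intro circle_holo_contour_integrable holomorphic_intros A_holo e_Basis \<phi>_holo) auto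

lemma norm_coef_le:
  assumes "norm x \<le> r" "p holomorphic_on ball 0 R" "\<And>w. norm w = \<rho> \<Longrightarrow> norm (p w) \<le> P" "0 \<le> P"
  shows "norm (coef x p n) \<le> \<rho> * M * P * (2 / \<rho>) ^ n"
proof -
  have "norm (contour_integral (circlepath 0 \<rho>) (\<lambda>w. A e w * p w / (w - \<phi> x w) ^ n)) \<le> (M * P * (2 / \<rho>) ^ n) * (2 * pi * \<rho>)"
  proof (rule has_contour_integral_bound_circlepath[OF has_contour_integral_integral[OF coef_integrable[OF assms(1,2)]]])
    fix w :: complex assume "norm (w - 0) = \<rho>"
    then have w: "norm w = \<rho>" by simp
    have "norm (A e w * p w / (w - \<phi> x w) ^ n) = norm (A e w) * norm (p w) * (1 / norm (w - \<phi> x w)) ^ n"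
      by (simp add: norm_divide norm_mult norm_power power_divide)
    also have "\<dots> \<le> M * P * (2 / \<rho>) ^ n"
    proof (intro mult_mono power_mono)
      show "1 / norm (w - \<phi> x w) \<le> 2 / \<rho>"
        using denominator_lower_bound[OF assms(1) w] \<rho> by (simp add: field_simps)
    qed (use A_bound[of w] assms w M \<rho> in auto)
    finally show "norm (A e w * p w / (w - \<phi> x w) ^ n) \<le> M * P * (2 / \<rho>) ^ n" .
  qed (use M \<rho> assms in auto)
  then show ?thesis
    unfolding coef_def by (simp add: norm_divide norm_mult field_simps)
qed

text \<open>On the circle \<open>\<phi> y\<close> is at most \<open>\<rho> / 4\<close> and
  \<open>w - \<phi> x w\<close> at least \<open>\<rho> / 2\<close>, so the geometric expansion has
  ratio at most 1/2 and its remainder decays uniformly in \<open>s\<close>.\<close>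

lemma curv_expansion:
  assumes x: "norm x \<le> r" and xs: "norm (x + s *\<^sub>R y) \<le> r" and s: "s \<in> {0..1}"
    and y: "real DIM('a) * M * norm y \<le> \<rho> / 4"
  shows "\<bar>curv (x + s *\<^sub>R y) y - (\<Sum>m<N. s ^ m * Re (coef x (\<lambda>w. \<phi> y w ^ (m + 2)) (Suc m)))\<bar> \<le> \<rho>\<^sup>2 * M / 8 * (1/2) ^ N"
proof -
  let ?C = "circlepath 0 \<rho>"
  define L where "L w = w - \<phi> x w" for w
  define I where "I m = contour_integral ?C (\<lambda>w. A e w * \<phi> y w ^ (m + 2) / L w ^ Suc m)" for m
  have den: "w - \<phi> (x + s *\<^sub>R y) w = L w - of_real s * \<phi> y w" for w
    by (simp add: L_def \<phi>_add \<phi>_scaleR)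
  have "((\<lambda>w. A e w * (\<phi> y w)\<^sup>2 / (w - \<phi> (x + s *\<^sub>R y) w) - (\<Sum>m<N. of_real s ^ m * (A e w * \<phi> y w ^ (m + 2) / L w ^ Suc m)))
      has_contour_integral (2 * of_real pi * \<i> * of_real (curv (x + s *\<^sub>R y) y) - (\<Sum>m<N. of_real s ^ m * I m))) ?C"
    unfolding I_def L_def
    by (intro has_contour_integral_diff has_contour_integral_sum has_contour_integral_lmul curv_contour_integral xs
        has_contour_integral_integral coef_integrable x holomorphic_intros \<phi>_holo) auto
  \<comment> \<open>The factors bound, in turn, \<open>A e\<close>, the square of
    \<open>\<phi> y\<close>, the ratio to the power \<open>N\<close> and the reciprocal of the
    shifted denominator; the last is the length of the circle.\<close>
  then have "norm (2 * of_real pi * \<i> * of_real (curv (x + s *\<^sub>R y) y) - (\<Sum>m<N. of_real s ^ m * I m))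
      \<le> (M * (\<rho> / 4)\<^sup>2 * ((1/2) ^ N * (2 / \<rho>))) * (2 * pi * \<rho>)"
  proof (rule has_contour_integral_bound_circlepath)
    fix w :: complex assume "norm (w - 0) = \<rho>"
    then have w: "norm w = \<rho>" by simp
    define p where "p = of_real s * \<phi> y w"
    have L: "\<rho> / 2 \<le> norm (L w)" "L w \<noteq> 0" unfolding L_def using denominator_lower_bound[OF x w] by auto
    have Lp: "\<rho> / 2 \<le> norm (L w - p)" "L w - p \<noteq> 0"
      using denominator_lower_bound[OF xs w] unfolding den p_def by auto
    have \<phi>y: "norm (\<phi> y w) \<le> \<rho> / 4"
      using order_trans[OF norm_\<phi>_le y] w by simp
    have "norm p \<le> 1 * (\<rho> / 4)"
      unfolding p_def norm_mult using \<phi>y s by (intro mult_mono) auto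
    then have "norm p / norm (L w) \<le> (\<rho> / 4) / (\<rho> / 2)"
      using L \<rho> by (intro frac_le) auto
    then have pL: "norm p / norm (L w) \<le> 1/2" using \<rho> by simp
    have "A e w * (\<phi> y w)\<^sup>2 / (L w - p) - (\<Sum>m<N. of_real s ^ m * (A e w * \<phi> y w ^ (m + 2) / L w ^ Suc m))
        = A e w * (\<phi> y w)\<^sup>2 * (1 / (L w - p) - (\<Sum>m<N. p ^ m / L w ^ Suc m))"
      by (simp add: right_diff_distrib sum_distrib_left p_def power_mult_distrib power_add mult_ac power2_eq_square)
    also have "\<dots> = A e w * (\<phi> y w)\<^sup>2 * ((p / L w) ^ N * (1 / (L w - p)))"
      by (subst geometric_remainder[OF L(2) Lp(2)]) (simp add: power_divide)
    also have "norm \<dots> = norm (A e w) * (norm (\<phi> y w))\<^sup>2 * ((norm p / norm (L w)) ^ N * (1 / norm (L w - p)))"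
      by (simp add: norm_mult norm_power norm_divide)
    also have "\<dots> \<le> M * (\<rho> / 4)\<^sup>2 * ((1/2) ^ N * (2 / \<rho>))"
    proof (intro mult_mono power_mono pL \<phi>y)
      show "1 / norm (L w - p) \<le> 2 / \<rho>" using Lp \<rho> by (simp add: field_simps)
    qed (use A_bound[of w] w M \<rho> in auto)
    finally show "norm (A e w * (\<phi> y w)\<^sup>2 / (w - \<phi> (x + s *\<^sub>R y) w) - (\<Sum>m<N. of_real s ^ m * (A e w * \<phi> y w ^ (m + 2) / L w ^ Suc m)))
       \<le> M * (\<rho> / 4)\<^sup>2 * ((1/2) ^ N * (2 / \<rho>))"
      unfolding den p_def .
  qed (use M \<rho> in auto)
  also have "\<dots> = (2 * pi) * (\<rho>\<^sup>2 * M / 8 * (1/2) ^ N)"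
    using \<rho> by (simp add: power2_eq_square field_simps)
  finally have 1: "norm (2 * of_real pi * \<i> * of_real (curv (x + s *\<^sub>R y) y) - (\<Sum>m<N. of_real s ^ m * I m))
      \<le> (2 * pi) * (\<rho>\<^sup>2 * M / 8 * (1/2) ^ N)" .
  define Q where "Q m = coef x (\<lambda>w. \<phi> y w ^ (m + 2)) (Suc m)" for m
  have IQ: "I m = 2 * of_real pi * \<i> * Q m" for m
    by (simp add: I_def Q_def coef_def L_def)
  define Z where "Z = of_real (curv (x + s *\<^sub>R y) y) - (\<Sum>m<N. of_real s ^ m * Q m)"
  have "2 * of_real pi * \<i> * of_real (curv (x + s *\<^sub>R y) y) - (\<Sum>m<N. of_real s ^ m * I m) = 2 * of_real pi * \<i> * Z"
    by (simp add: Z_def IQ right_diff_distrib sum_distrib_left mult_ac)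
  then have "(2 * pi) * norm Z \<le> (2 * pi) * (\<rho>\<^sup>2 * M / 8 * (1/2) ^ N)"
    using 1 by (simp add: norm_mult)
  then have "norm Z \<le> \<rho>\<^sup>2 * M / 8 * (1/2) ^ N"
    by (subst (asm) mult_le_cancel_left_pos) auto
  moreover have "Re Z = curv (x + s *\<^sub>R y) y - (\<Sum>m<N. s ^ m * Re (Q m))"
    by (simp add: Z_def of_real_power[symmetric] del: of_real_power)
  ultimately show ?thesis
    using abs_Re_le_cmod[of Z] by (simp add: Q_def)
qed

text \<open>Integrating \<open>s ^ m\<close> twice from 0 and setting \<open>s = 1\<close> gives
  \<open>1 / ((m + 1) * (m + 2))\<close>; the value and gradient at \<open>x\<close> are the two
  constants of integration.\<close>

lemma u_expansion:
  assumes x: "norm x < r" and xy: "norm x + norm y < r"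
    and y: "real DIM('a) * M * norm y \<le> \<rho> / 4"
  shows "(\<lambda>m. Re (coef x (\<lambda>w. \<phi> y w ^ (m + 2)) (Suc m)) / (real (m + 1) * real (m + 2))) sums
      (u (x + y) - u x - g (\<tau> x) \<bullet> y)"
proof -
  define q where "q m = Re (coef x (\<lambda>w. \<phi> y w ^ (m + 2)) (Suc m))" for m
  have xs: "norm (x + s *\<^sub>R y) < r" if "s \<in> {0..1}" for s
  proof -
    have "norm (x + s *\<^sub>R y) \<le> norm x + \<bar>s\<bar> * norm y" using norm_triangle_ineq[of x "s *\<^sub>R y"] by simp
    also have "\<bar>s\<bar> * norm y \<le> 1 * norm y" using that by (intro mult_right_mono) auto
    finally show ?thesis using xy by simp
  qed
  have bound: "\<bar>u (x + y) - u x - g (\<tau> x) \<bullet> y - (\<Sum>m<N. q m / (real (m + 1) * real (m + 2)))\<bar> \<le> \<rho>\<^sup>2 * M / 8 * (1/2) ^ N" for N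
  proof -
    \<comment> \<open>\<open>U\<close> is the expansion error along the segment. It and its
      derivative vanish at \<open>s = 0\<close>, and its second derivative is the error for
      \<open>curv\<close>.\<close>
    define U where "U s = u (x + s *\<^sub>R y) - u x - s * (g (\<tau> x) \<bullet> y)
       - (\<Sum>m<N. q m / (real (m + 1) * real (m + 2)) * s ^ (m + 2))" for s
    define U' where "U' s = g (\<tau> (x + s *\<^sub>R y)) \<bullet> y - g (\<tau> x) \<bullet> y
       - (\<Sum>m<N. q m / real (m + 1) * s ^ (m + 1))" for s
    have cancel: "a / (b * c) * (c * z) = a / b * z" if "c \<noteq> 0" for a b c z :: real
      using that by simp
    have nz: "real (m + 1) \<noteq> 0" "real (m + 2) \<noteq> 0" for m by (simp_all del: of_nat_add)
    have "\<bar>U 1\<bar> \<le> \<rho>\<^sup>2 * M / 8 * (1/2) ^ N"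
    proof (rule second_order_bound)
      fix s :: real assume s: "s \<in> {0..1}"
      show "(U has_real_derivative U' s) (at s)"
        unfolding U_def[abs_def] U'_def
      proof (rule DERIV_cong)
        show "((\<lambda>s. u (x + s *\<^sub>R y) - u x - s * (g (\<tau> x) \<bullet> y) - (\<Sum>m<N. q m / (real (m + 1) * real (m + 2)) * s ^ (m + 2)))
          has_real_derivative (g (\<tau> (x + s *\<^sub>R y)) \<bullet> y - 0 - 1 * (g (\<tau> x) \<bullet> y)
            - (\<Sum>m<N. q m / (real (m + 1) * real (m + 2)) * (real (m + 2) * s ^ (m + 2 - Suc 0))))) (at s)"
          by (intro DERIV_diff u_line_derivatives(1) xs[OF s] DERIV_const DERIV_cmult_right DERIV_ident
              DERIV_sum DERIV_cmult DERIV_pow)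
      qed (simp only: cancel[OF nz(2)], simp)
      show "(U' has_real_derivative curv (x + s *\<^sub>R y) y - (\<Sum>m<N. s ^ m * q m)) (at s)"
        unfolding U'_def[abs_def]
      proof (rule DERIV_cong)
        show "((\<lambda>s. g (\<tau> (x + s *\<^sub>R y)) \<bullet> y - g (\<tau> x) \<bullet> y - (\<Sum>m<N. q m / real (m + 1) * s ^ (m + 1)))
          has_real_derivative (curv (x + s *\<^sub>R y) y - 0
            - (\<Sum>m<N. q m / real (m + 1) * (real (m + 1) * s ^ (m + 1 - Suc 0))))) (at s)"
          by (intro DERIV_diff u_line_derivatives(2) xs[OF s] DERIV_const DERIV_sum DERIV_cmult DERIV_pow)
      qed (simp add: mult.commute nz del: of_nat_add)
      show "\<bar>curv (x + s *\<^sub>R y) y - (\<Sum>m<N. s ^ m * q m)\<bar> \<le> \<rho>\<^sup>2 * M / 8 * (1/2) ^ N"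
        unfolding q_def using x xs[OF s] by (intro curv_expansion s y) auto
    qed (auto simp: U_def U'_def)
    then show ?thesis by (simp add: U_def)
  qed
  have "(\<lambda>N. \<rho>\<^sup>2 * M / 8 * (1/2) ^ N) \<longlonglongrightarrow> \<rho>\<^sup>2 * M / 8 * 0"
    by (intro tendsto_mult tendsto_const LIMSEQ_power_zero) auto
  then have "(\<lambda>N. \<rho>\<^sup>2 * M / 8 * (1/2) ^ N) \<longlonglongrightarrow> 0" by simp
  then have "(\<lambda>N. (\<Sum>m<N. q m / (real (m + 1) * real (m + 2))) - (u (x + y) - u x - g (\<tau> x) \<bullet> y)) \<longlonglongrightarrow> 0"
    by (rule Lim_null_comparison[rotated]) (use bound in \<open>auto simp: abs_minus_commute\<close>)
  then show ?thesis unfolding sums_def q_def by (rule LIM_zero_cancel)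
qed


section \<open>From contour integrals to a multivariate power series\<close>

definition Bword :: "'a list \<Rightarrow> complex \<Rightarrow> complex" where
  "Bword ws w = prod_list (map (\<lambda>b. B b w) ws)"

lemma Bword_holo: "set ws \<subseteq> Basis \<Longrightarrow> Bword ws holomorphic_on ball 0 R"
  unfolding Bword_def[abs_def] by (induction ws) (auto intro!: holomorphic_intros B_holo)

lemma norm_Bword_le:
  assumes "set ws \<subseteq> Basis" "norm w = \<rho>" shows "norm (Bword ws w) \<le> M ^ length ws"
  using assms(1)
proof (induction ws)
  case (Cons b ws)
  then have "norm (B b w) * norm (Bword ws w) \<le> M * M ^ length ws"
    using B_bound[of b w] assms(2) M by (intro mult_mono) (auto simp: B_def)
  then show ?case by (simp add: Bword_def norm_mult)
qed (simp add: Bword_def)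

text \<open>This separates the variables: \<open>y\<close> enters only through monomials, which can
  be pulled out of the contour integrals.\<close>

lemma \<phi>_power_words: "\<phi> y w ^ n = (\<Sum>ws\<in>words n. of_real (wpow ws y) * Bword ws w)"
proof -
  have "prod_list (map (\<lambda>b. of_real (y \<bullet> b) * B b w) ws) = of_real (wpow ws y) * Bword ws w" for ws
    by (induction ws) (auto simp: wpow_def Bword_def)
  then show ?thesis unfolding \<phi>_def sum_power_words by simp
qed

lemma coef_words:
  assumes "norm x \<le> r"
  shows "Re (coef x (\<lambda>w. \<phi> y w ^ n) m) = (\<Sum>ws\<in>words n. wpow ws y * Re (coef x (Bword ws) m))"
proof -
  have int: "(\<lambda>w. A e w * Bword ws w / (w - \<phi> x w) ^ m) contour_integrable_on (circlepath 0 \<rho>)" if "ws \<in> words n" for ws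
    using that by (intro coef_integrable assms Bword_holo) (auto simp: words_def)
  have "(\<lambda>w. A e w * \<phi> y w ^ n / (w - \<phi> x w) ^ m)
      = (\<lambda>w. \<Sum>ws\<in>words n. of_real (wpow ws y) * (A e w * Bword ws w / (w - \<phi> x w) ^ m))"
    unfolding \<phi>_power_words by (simp add: sum_distrib_left sum_divide_distrib mult_ac)
  moreover have "((\<lambda>w. \<Sum>ws\<in>words n. of_real (wpow ws y) * (A e w * Bword ws w / (w - \<phi> x w) ^ m)) has_contour_integral
      (\<Sum>ws\<in>words n. of_real (wpow ws y) *
         contour_integral (circlepath 0 \<rho>) (\<lambda>w. A e w * Bword ws w / (w - \<phi> x w) ^ m))) (circlepath 0 \<rho>)"
    by (intro has_contour_integral_sum has_contour_integral_lmul has_contour_integral_integral int) auto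
  ultimately have "coef x (\<lambda>w. \<phi> y w ^ n) m = (\<Sum>ws\<in>words n. of_real (wpow ws y) * coef x (Bword ws) m)"
    unfolding coef_def by (simp only: contour_integral_unique sum_divide_distrib times_divide_eq_right)
  then show ?thesis by simp
qed

text \<open>The expansion of \<open>u\<close> becomes a series over words, and geometric bounds on
  its coefficients allow regrouping by multi-indices.\<close>

lemma u_power_series:
  assumes x: "norm x < r"
  shows "\<exists>\<delta>>0. \<exists>c. \<forall>y. norm y < \<delta> \<longrightarrow> ((\<lambda>\<alpha>. c \<alpha> * mpow \<alpha> y) has_sum u (x + y)) multi_indices"
proof -
  define K where "K = 2 * M / \<rho>"
  have K: "K > 0" using M \<rho> by (simp add: K_def)
  define T where "T ws = (if ws = [] then u x else if length ws = 1 then g (\<tau> x) \<bullet> hd ws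
     else Re (coef x (Bword ws) (length ws - 1)) / (real (length ws - 1) * real (length ws)))" for ws
  \<comment> \<open>One summand for each case of the bound: length 0, length 1, and length at least
    2.\<close>
  define C where "C = \<bar>u x\<bar> + norm (g (\<tau> x)) / K + \<rho>\<^sup>2 * M / 2"
  have C: "\<bar>u x\<bar> \<le> C" "norm (g (\<tau> x)) \<le> C * K" "\<rho>\<^sup>2 * M / 2 \<le> C"
    using K M by (auto simp: C_def field_simps)
  have T_bound: "\<bar>T ws\<bar> \<le> C * K ^ n" if "ws \<in> words n" for n ws
  proof -
    have ws: "set ws \<subseteq> Basis" "length ws = n" using that by (auto simp: words_def)
    consider "n = 0" | "n = 1" | m where "n = m + 2"
      by (metis One_nat_def add_2_eq_Suc' not0_implies_Suc)
    then show ?thesis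
    proof cases
      case 1 then show ?thesis using ws C by (simp add: T_def)
    next
      case 2
      then obtain b where b: "ws = [b]" "b \<in> Basis" using ws by (cases ws) auto
      then show ?thesis using 2 C(2) Basis_le_norm[OF b(2), of "g (\<tau> x)"] by (simp add: T_def)
    next
      case 3
      have "ws \<noteq> []" "length ws \<noteq> 1" using ws 3 by auto
      then have "T ws = Re (coef x (Bword ws) (m + 1)) / (real (m + 1) * real (m + 2))"
        using ws 3 by (simp add: T_def)
      then have "\<bar>T ws\<bar> = \<bar>Re (coef x (Bword ws) (m + 1))\<bar> / (real (m + 1) * real (m + 2))"
        by (simp add: abs_mult)
      also have "\<dots> \<le> \<bar>Re (coef x (Bword ws) (m + 1))\<bar> / 1"
        by (rule frac_le) (use mult_mono[of 1 "real (m + 1)" 1 "real (m + 2)"] in auto)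
      also have "\<dots> \<le> norm (coef x (Bword ws) (m + 1))" using abs_Re_le_cmod by simp
      also have "\<dots> \<le> \<rho> * M * M ^ n * (2 / \<rho>) ^ (m + 1)"
        using x ws M by (intro norm_coef_le Bword_holo) (auto intro: norm_Bword_le)
      also have "\<dots> = \<rho>\<^sup>2 * M / 2 * K ^ n"
        using 3 \<rho> by (simp add: K_def power_divide power_mult_distrib power2_eq_square)
      also have "\<dots> \<le> C * K ^ n" using C K by (intro mult_right_mono) auto
      finally show ?thesis .
    qed
  qed
  \<comment> \<open>The first entry keeps the segment from \<open>x\<close> to \<open>x + y\<close>
    in the ball of radius \<open>r\<close>; the second meets the smallness condition of
    \<open>u_expansion\<close> and makes \<open>DIM('a) * K * \<delta>\<close> at most 1/2.\<close>
  define \<delta> where "\<delta> = min ((r - norm x) / 2) (\<rho> / (4 * (real DIM('a) * M)))"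
  have DM: "real DIM('a) * M > 0" using M by simp
  have \<delta>: "\<delta> > 0" using x \<rho> DM by (simp add: \<delta>_def)
  have \<delta>1: "real DIM('a) * M * \<delta> \<le> \<rho> / 4"
  proof -
    have "real DIM('a) * M * \<delta> \<le> real DIM('a) * M * (\<rho> / (4 * (real DIM('a) * M)))"
      using DM by (intro mult_left_mono) (auto simp: \<delta>_def)
    also have "\<dots> = \<rho> / 4" using M by simp
    finally show ?thesis .
  qed
  have "real DIM('a) * K * \<delta> = 2 / \<rho> * (real DIM('a) * M * \<delta>)" by (simp add: K_def)
  also have "\<dots> \<le> 2 / \<rho> * (\<rho> / 4)" using \<delta>1 \<rho> by (intro mult_left_mono) auto
  also have "\<dots> < 1" using \<rho> by simp
  finally have \<delta>2: "real DIM('a) * K * \<delta> < 1" .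
  have "\<exists>c. \<forall>y S. norm y \<le> \<delta> \<longrightarrow> (\<lambda>n. \<Sum>ws\<in>words n. T ws * wpow ws y) sums S \<longrightarrow>
     ((\<lambda>\<alpha>. c \<alpha> * mpow \<alpha> y) has_sum S) multi_indices"
    by (rule has_sum_of_word_series[OF T_bound]) (use K \<delta> \<delta>2 in auto)
  then obtain c where c: "\<forall>y S. norm y \<le> \<delta> \<longrightarrow> (\<lambda>n. \<Sum>ws\<in>words n. T ws * wpow ws y) sums S \<longrightarrow>
     ((\<lambda>\<alpha>. c \<alpha> * mpow \<alpha> y) has_sum S) multi_indices"
    by (rule exE)
  have "(\<lambda>n. \<Sum>ws\<in>words n. T ws * wpow ws y) sums u (x + y)" if "norm y < \<delta>" for y
  proof -
    have y: "norm x + norm y < r" using that x by (auto simp: \<delta>_def)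
    have "real DIM('a) * M * norm y \<le> real DIM('a) * M * \<delta>"
      using DM that by (intro mult_left_mono) auto
    then have y': "real DIM('a) * M * norm y \<le> \<rho> / 4" using \<delta>1 by linarith
    have eq: "(\<Sum>ws\<in>words (m + 2). T ws * wpow ws y)
        = Re (coef x (\<lambda>w. \<phi> y w ^ (m + 2)) (Suc m)) / (real (m + 1) * real (m + 2))" for m
    proof -
      have "T ws = Re (coef x (Bword ws) (Suc m)) / (real (m + 1) * real (m + 2))" if "ws \<in> words (m + 2)" for ws
      proof -
        have "length ws = m + 2" using that by (simp add: words_def)
        moreover from this have "ws \<noteq> []" by auto
        ultimately show ?thesis by (simp add: T_def)
      qed
      then have "(\<Sum>ws\<in>words (m + 2). T ws * wpow ws y)
          = (\<Sum>ws\<in>words (m + 2). wpow ws y * Re (coef x (Bword ws) (Suc m)) / (real (m + 1) * real (m + 2)))"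
        by (intro sum.cong) (auto simp: mult_ac)
      then show ?thesis using x by (simp only: coef_words[OF less_imp_le] sum_divide_distrib)
    qed
    have "(\<lambda>m. \<Sum>ws\<in>words (m + 2). T ws * wpow ws y) sums (u (x + y) - u x - g (\<tau> x) \<bullet> y)"
      unfolding eq by (rule u_expansion[OF x y y'])
    then have "(\<lambda>n. \<Sum>ws\<in>words n. T ws * wpow ws y) sums
       (u (x + y) - u x - g (\<tau> x) \<bullet> y + (\<Sum>i<2. \<Sum>ws\<in>words i. T ws * wpow ws y))"
      using sums_iff_shift[of "\<lambda>n. \<Sum>ws\<in>words n. T ws * wpow ws y" 2] by simp
    moreover have "(\<Sum>ws\<in>words 1. T ws * wpow ws y) = g (\<tau> x) \<bullet> y"
    proof -
      have "words 1 = (\<lambda>b. [b]) ` (Basis :: 'a set)"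
        using words_Suc[of 0, where 'a = 'a] by (auto simp: image_iff)
      then have "(\<Sum>ws\<in>words 1. T ws * wpow ws y) = (\<Sum>b\<in>Basis. (g (\<tau> x) \<bullet> b) * (y \<bullet> b))"
        by (simp add: sum.reindex inj_on_def T_def wpow_def)
      then show ?thesis using euclidean_inner[of "g (\<tau> x)" y] by simp
    qed
    moreover have "(\<Sum>ws\<in>words 0. T ws * wpow ws y) = u x" by (simp add: T_def wpow_def)
    ultimately show ?thesis by (simp add: numeral_2_eq_2)
  qed
  then show ?thesis using c \<delta> by (intro exI[of _ \<delta>] conjI exI[of _ c]) auto
qed

lemma u_analytic: "real_analytic_on u (ball 0 r)"
  unfolding real_analytic_on_def
proof (intro ballI)
  fix a :: 'a and j :: real assume a: "a \<in> ball 0 r" and "j \<in> Basis"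
  then have j: "j = 1" by simp
  obtain \<delta> c where \<delta>: "\<delta> > 0"
    and c: "\<And>y. norm y < \<delta> \<Longrightarrow> ((\<lambda>\<alpha>. c \<alpha> * mpow \<alpha> y) has_sum u (a + y)) multi_indices"
    using u_power_series[of a] a by auto
  have "((\<lambda>\<alpha>. c \<alpha> * (\<Prod>b\<in>Basis. ((x - a) \<bullet> b) ^ \<alpha> b)) has_sum u x \<bullet> j) multi_indices" if "x \<in> ball a \<delta>" for x
    using c[of "x - a"] that by (simp add: j mpow_def dist_norm norm_minus_commute)
  then show "\<exists>r>0. \<exists>c. \<forall>x\<in>ball a r. ((\<lambda>\<alpha>. c \<alpha> * (\<Prod>b\<in>Basis. ((x - a) \<bullet> b) ^ \<alpha> b)) has_sum u x \<bullet> j) multi_indices"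
    using \<delta> by blast
qed

end

section \<open>Choice of the radii and bounds\<close>

lemma gauss_curve_exists:
  fixes e :: "'a::euclidean_space"
  assumes e: "e \<in> Basis" and R: "0 < R"
    and G: "\<And>b. b \<in> Basis \<Longrightarrow> G b holomorphic_on ball 0 R"
    and G_real: "\<And>b t. b \<in> Basis \<Longrightarrow> \<bar>t\<bar> < R \<Longrightarrow> G b (of_real t) = of_real (g t \<bullet> b)"
    and nz: "deriv (G e) 0 \<noteq> 0"
  shows "\<exists>R' \<rho> M r. gauss_curve e g G R' \<rho> M r \<and> R' \<le> R \<and> r \<le> \<rho>"
proof -
  have "deriv (G e) holomorphic_on ball 0 R" using G[OF e] by (intro holomorphic_deriv) auto
  then have "continuous_on (ball 0 R) (deriv (G e))" by (rule holomorphic_on_imp_continuous_on)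
  then obtain R1 where R1: "0 < R1" "\<And>w. dist 0 w < R1 \<Longrightarrow> deriv (G e) w \<noteq> 0"
    using continuous_on_open_avoid[of "ball 0 R" "deriv (G e)" 0 0] nz R by auto
  define R' where "R' = min R R1"
  \<comment> \<open>Half the radius puts a compact disc inside the open one, so functions
    holomorphic on the latter are bounded there.\<close>
  define \<rho> where "\<rho> = R' / 2"
  have R': "0 < R'" "R' \<le> R" "0 < \<rho>" "\<rho> < R'" using R R1 by (auto simp: R'_def \<rho>_def)
  have A_nz: "deriv (G e) w \<noteq> 0" if "w \<in> ball 0 R'" for w using that R1 by (auto simp: R'_def)
  have sub: "ball 0 R' \<subseteq> ball (0::complex) R" using R' by auto
  have A_holo: "deriv (G b) holomorphic_on ball 0 R'" if "b \<in> Basis" for b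
    using holomorphic_on_subset[OF G[OF that] sub] by (intro holomorphic_deriv) auto
  have B_holo: "(\<lambda>w. deriv (G b) w / deriv (G e) w) holomorphic_on ball 0 R'" if "b \<in> Basis" for b
    by (intro holomorphic_on_divide A_holo that e A_nz)
  have bnd: "\<exists>m. \<forall>w\<in>cball 0 \<rho>. norm (f w) \<le> m" if "f holomorphic_on ball 0 R'" for f :: "complex \<Rightarrow> complex"
  proof -
    have "continuous_on (cball 0 \<rho>) f"
      using R' by (intro continuous_on_subset[OF holomorphic_on_imp_continuous_on[OF that]]) auto
    then have "bounded (f ` cball 0 \<rho>)"
      by (intro compact_imp_bounded compact_continuous_image) auto
    then show ?thesis by (auto simp: bounded_iff)
  qed
  obtain mA where mA: "\<And>w. w \<in> cball 0 \<rho> \<Longrightarrow> norm (deriv (G e) w) \<le> mA" using bnd[OF A_holo[OF e]] by blast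
  have "\<forall>b\<in>Basis. \<exists>m. \<forall>w\<in>cball 0 \<rho>. norm (deriv (G b) w / deriv (G e) w) \<le> m"
    using bnd B_holo by blast
  then obtain mB where mB: "\<And>b w. b \<in> Basis \<Longrightarrow> w \<in> cball 0 \<rho> \<Longrightarrow> norm (deriv (G b) w / deriv (G e) w) \<le> mB b"
    by metis
  have "\<forall>b\<in>Basis. \<exists>m. \<forall>w\<in>cball 0 \<rho>. norm (deriv (\<lambda>w. deriv (G b) w / deriv (G e) w) w) \<le> m"
    using bnd B_holo holomorphic_deriv by blast
  then obtain mD where mD: "\<And>b w. b \<in> Basis \<Longrightarrow> w \<in> cball 0 \<rho> \<Longrightarrow>
      norm (deriv (\<lambda>w. deriv (G b) w / deriv (G e) w) w) \<le> mD b"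
    by metis
  \<comment> \<open>The sum dominates the bound for every basis vector at once; the leading 1 makes
    \<open>M\<close> positive.\<close>
  define M where "M = 1 + \<bar>mA\<bar> + (\<Sum>b\<in>Basis. \<bar>mB b\<bar> + \<bar>mD b\<bar>)"
  have M0: "0 \<le> (\<Sum>b\<in>Basis. \<bar>mB b\<bar> + \<bar>mD b\<bar>)" by (intro sum_nonneg) auto
  have Mb: "mB b \<le> M" "mD b \<le> M" if "b \<in> Basis" for b
  proof -
    have "\<bar>mB b\<bar> + \<bar>mD b\<bar> \<le> (\<Sum>b\<in>Basis. \<bar>mB b\<bar> + \<bar>mD b\<bar>)"
      using that by (intro member_le_sum) auto
    then show "mB b \<le> M" "mD b \<le> M" by (auto simp: M_def)
  qed
  have M: "0 < M" "mA \<le> M" using M0 by (auto simp: M_def)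
  \<comment> \<open>The entry \<open>\<rho>\<close> places the axis points of the ball within reach
    of \<open>\<tau>_axis\<close>; the other entry encodes both smallness conditions.\<close>
  define r where "r = min \<rho> (min (\<rho> / 2) (1 / 2) / (real DIM('a) * M))"
  have DM: "real DIM('a) * M > 0" using M by simp
  have r: "0 < r" using R' DM by (simp add: r_def)
  have "real DIM('a) * M * r \<le> real DIM('a) * M * (min (\<rho> / 2) (1 / 2) / (real DIM('a) * M))"
    using DM by (intro mult_left_mono) (auto simp: r_def)
  also have "\<dots> = min (\<rho> / 2) (1 / 2)" using M by simp
  finally have r': "real DIM('a) * M * r \<le> \<rho> / 2" "real DIM('a) * M * r \<le> 1 / 2" by (simp_all only: min.bounded_iff)
  have "gauss_curve e g G R' \<rho> M r"
    using e R' M r r' A_nz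
    by unfold_locales
      (auto intro: holomorphic_on_subset[OF G sub] G_real order_trans[OF mA] order_trans[OF mB Mb(1)] order_trans[OF mD Mb(2)]
        simp del: min.bounded_iff)
  then show ?thesis using R' by (intro exI[of _ R'] exI[of _ \<rho>] exI[of _ M] exI[of _ r]) (auto simp: r_def)
qed

section \<open>Uniqueness\<close>

context gauss_curve
begin

text \<open>Rank one enters as \<open>ker\<close>: the kernel of the \<open>e\<close>-component of
  \<open>V'\<close> is contained in the kernel of \<open>V'\<close>. This makes both the gradient
  and the Legendre transform constant on level sets of \<open>V x \<bullet> e\<close>.\<close>

lemma u_unique:
  assumes s: "0 < s" and v0: "v 0 = 0"
    and dv: "\<And>x. x \<in> ball 0 s \<Longrightarrow> (v has_derivative (\<lambda>h. V x \<bullet> h)) (at x)"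
    and dV: "\<And>x. x \<in> ball 0 s \<Longrightarrow> (V has_derivative V' x) (at x)"
    and D: "continuous_on (ball 0 s) D" "\<And>x h. x \<in> ball 0 s \<Longrightarrow> V' x h \<bullet> e = h \<bullet> D x"
    and nz: "\<And>x. x \<in> ball 0 s \<Longrightarrow> D x \<bullet> e \<noteq> 0"
    and ker: "\<And>x h. x \<in> ball 0 s \<Longrightarrow> h \<bullet> D x = 0 \<Longrightarrow> V' x h = 0"
    and axis: "\<And>t. \<bar>t\<bar> < s \<Longrightarrow> V (t *\<^sub>R e) = g t"
  shows "\<exists>\<epsilon>>0. \<forall>x\<in>ball 0 \<epsilon>. v x = u x"
proof -
  define s' where "s' = min s (min r \<rho>)"
  have s': "0 < s'" "s' \<le> s" "s' \<le> r" "s' \<le> \<rho>" using s r \<rho> by (auto simp: s'_def)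
  then have sub: "ball 0 s' \<subseteq> ball (0::'a) s" by auto
  define \<psi> where "\<psi> x = V x \<bullet> e - V 0 \<bullet> e" for x
  have \<psi>: "(\<psi> has_derivative (\<lambda>h. h \<bullet> D x)) (at x)" if "x \<in> ball 0 s'" for x
  proof -
    have x: "x \<in> ball 0 s" using that sub by blast
    have "(\<psi> has_derivative (\<lambda>h. V' x h \<bullet> e - 0)) (at x)"
      unfolding \<psi>_def[abs_def]
      by (intro has_derivative_diff has_derivative_inner_left dV x has_derivative_const)
    then show ?thesis using D(2)[OF x] by simp
  qed
  \<comment> \<open>the Legendre transform: its derivative \<open>V' x h \<bullet> x\<close> vanishes on the kernel of \<open>V' x\<close>\<close>
  define W where "W x = V x \<bullet> x - v x" for x
  define f where "f x = (V x, W x)" for x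
  have dW: "(W has_derivative (\<lambda>h. V' x h \<bullet> x)) (at x)" if "x \<in> ball 0 s" for x
  proof -
    have "(W has_derivative (\<lambda>h. V x \<bullet> h + V' x h \<bullet> x - V x \<bullet> h)) (at x)"
      unfolding W_def[abs_def]
      by (intro has_derivative_diff has_derivative_inner has_derivative_ident dV dv that)
    then show ?thesis by simp
  qed
  have df: "(f has_derivative (\<lambda>h. (V' x h, V' x h \<bullet> x))) (at x)" if "x \<in> ball 0 s" for x
    unfolding f_def[abs_def] by (intro has_derivative_Pair dV dW that)
  obtain \<epsilon> \<sigma> where \<epsilon>: "0 < \<epsilon>" "\<epsilon> \<le> s'"
    and \<sigma>_diff: "\<And>x. x \<in> ball 0 \<epsilon> \<Longrightarrow> \<sigma> differentiable (at x)"
    and \<sigma>_in: "\<And>x. x \<in> ball 0 \<epsilon> \<Longrightarrow> \<sigma> x *\<^sub>R e \<in> ball 0 s'"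
    and f_const: "\<And>(F :: 'a \<Rightarrow> 'a \<times> real) F' x. (\<And>z. z \<in> ball 0 s' \<Longrightarrow> (F has_derivative F' z) (at z)) \<Longrightarrow>
       (\<And>z h. z \<in> ball 0 s' \<Longrightarrow> h \<bullet> D z = 0 \<Longrightarrow> F' z h = 0) \<Longrightarrow> x \<in> ball 0 \<epsilon> \<Longrightarrow> F x = F (\<sigma> x *\<^sub>R e)"
  proof (rule level_set_retraction[OF e_Basis s'(1) _ \<psi>])
    show "\<psi> 0 = 0" by (simp add: \<psi>_def)
    show "continuous_on (ball 0 s') D" using D(1) sub by (rule continuous_on_subset)
    show "D 0 \<bullet> e \<noteq> 0" using nz s by simp
  qed (assumption | blast)+
  have fx: "f x = f (\<sigma> x *\<^sub>R e)" if "x \<in> ball 0 \<epsilon>" for x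
  proof (rule f_const[OF _ _ that])
    show "(f has_derivative (\<lambda>h. (V' z h, V' z h \<bullet> z))) (at z)" if "z \<in> ball 0 s'" for z
      using that sub by (intro df) auto
    show "(V' z h, V' z h \<bullet> z) = 0" if "z \<in> ball 0 s'" "h \<bullet> D z = 0" for z h
      using ker[of z h] that sub by (auto simp: zero_prod_def)
  qed
  have \<sigma>_lt: "\<bar>\<sigma> x\<bar> < s'" if "x \<in> ball 0 \<epsilon>" for x
    using \<sigma>_in[OF that] e_Basis by simp
  \<comment> \<open>The Legendre transform along the axis; in its derivative the contribution of
    \<open>v\<close> cancels and \<open>t * (g' t \<bullet> e)\<close> remains.\<close>
  define k where "k t = t * (g t \<bullet> e) - v (t *\<^sub>R e)" for t
  have V\<sigma>: "V x = g (\<sigma> x)" and W\<sigma>: "W x = k (\<sigma> x)" if "x \<in> ball 0 \<epsilon>" for x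
    using fx[OF that] axis[of "\<sigma> x"] \<sigma>_lt[OF that] s' by (auto simp: f_def W_def k_def)
  have dk: "(k has_real_derivative t * (g' t \<bullet> e)) (at t)" if t: "\<bar>t\<bar> < s'" for t
  proof -
    have tR: "\<bar>t\<bar> < R" using t s' \<rho> by simp
    have line: "((\<lambda>t. t *\<^sub>R e) has_derivative (\<lambda>h. h *\<^sub>R e)) (at t)"
      by (auto intro!: derivative_eq_intros)
    have te: "t *\<^sub>R e \<in> ball 0 s" using t s' e_Basis by simp
    have "((\<lambda>t. v (t *\<^sub>R e)) has_derivative (\<lambda>h. V (t *\<^sub>R e) \<bullet> (h *\<^sub>R e))) (at t)"
      by (rule has_derivative_compose[OF line dv[OF te]])
    then have 1: "((\<lambda>t. v (t *\<^sub>R e)) has_real_derivative g t \<bullet> e) (at t)"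
      using axis[of t] t s' by (simp add: has_field_derivative_def mult.commute[of _ "g t \<bullet> e"])
    have "((\<lambda>t. g t \<bullet> e) has_derivative (\<lambda>h. (h *\<^sub>R g' t) \<bullet> e)) (at t)"
      by (rule has_derivative_inner_left[OF g_has_vector_derivative[OF tR, unfolded has_vector_derivative_def]])
    then have 2: "((\<lambda>t. g t \<bullet> e) has_real_derivative g' t \<bullet> e) (at t)"
      by (simp add: has_field_derivative_def mult.commute[of _ "g' t \<bullet> e"])
    show ?thesis
      unfolding k_def[abs_def] by (auto intro!: derivative_eq_intros 1 2)
  qed
  have \<sigma>\<tau>: "\<tau> x = \<sigma> x" if x: "x \<in> ball 0 \<epsilon>" for x
  proof (rule \<tau>_of_orthogonal)
    have xs: "x \<in> ball 0 s" using x \<epsilon> s' by auto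
    show "norm x \<le> r" "\<bar>\<sigma> x\<bar> \<le> \<rho>" using x \<epsilon> s' \<sigma>_lt[OF x] by auto
    obtain \<sigma>' where \<sigma>': "(\<sigma> has_derivative \<sigma>') (at x)"
      using \<sigma>_diff[OF x] by (auto simp: differentiable_def)
    have tR: "\<bar>\<sigma> x\<bar> < R" using \<sigma>_lt[OF x] s' \<rho> by simp
    have "((\<lambda>x. g (\<sigma> x)) has_derivative (\<lambda>h. \<sigma>' h *\<^sub>R g' (\<sigma> x))) (at x)"
      by (rule has_derivative_compose[OF \<sigma>' g_has_vector_derivative[OF tR, unfolded has_vector_derivative_def]])
    then have "(V has_derivative (\<lambda>h. \<sigma>' h *\<^sub>R g' (\<sigma> x))) (at x)"
      by (rule has_derivative_transform_within_open[OF _ open_ball x]) (simp add: V\<sigma>)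
    then have V': "V' x = (\<lambda>h. \<sigma>' h *\<^sub>R g' (\<sigma> x))"
      using dV[OF xs] has_derivative_unique by blast
    have "((\<lambda>x. k (\<sigma> x)) has_derivative (\<lambda>h. (\<sigma> x * (g' (\<sigma> x) \<bullet> e)) * \<sigma>' h)) (at x)"
      by (rule has_derivative_compose[OF \<sigma>' dk[OF \<sigma>_lt[OF x], unfolded has_field_derivative_def]])
    then have "(W has_derivative (\<lambda>h. (\<sigma> x * (g' (\<sigma> x) \<bullet> e)) * \<sigma>' h)) (at x)"
      by (rule has_derivative_transform_within_open[OF _ open_ball x]) (simp add: W\<sigma>)
    then have "(\<lambda>h. V' x h \<bullet> x) = (\<lambda>h. (\<sigma> x * (g' (\<sigma> x) \<bullet> e)) * \<sigma>' h)"
      using dW[OF xs] has_derivative_unique by blast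
    \<comment> \<open>Comparing the two expressions for the derivative of \<open>W\<close> in
      direction \<open>e\<close>, where \<open>\<sigma>'\<close> is nonzero, yields the root
      equation for \<open>\<sigma> x\<close>.\<close>
    then have "V' x e \<bullet> x = (\<sigma> x * (g' (\<sigma> x) \<bullet> e)) * \<sigma>' e" by meson
    then have eq: "\<sigma>' e * (g' (\<sigma> x) \<bullet> x) = \<sigma>' e * (\<sigma> x * (g' (\<sigma> x) \<bullet> e))" by (simp add: V')
    have "V' x e \<bullet> e \<noteq> 0" using D(2)[OF xs] nz[OF xs] by (simp add: inner_commute)
    then have "\<sigma>' e \<noteq> 0" by (auto simp: V')
    then show "g' (\<sigma> x) \<bullet> (x - \<sigma> x *\<^sub>R e) = 0" using eq by (simp add: inner_diff_right)
  qed
  have "((\<lambda>x. v x - u x) has_derivative (\<lambda>h. 0)) (at x within ball 0 \<epsilon>)" if x: "x \<in> ball 0 \<epsilon>" for x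
  proof -
    have "x \<in> ball 0 s" "norm x < r" using x \<epsilon> s' by auto
    then have "((\<lambda>x. v x - u x) has_derivative (\<lambda>h. V x \<bullet> h - g (\<tau> x) \<bullet> h)) (at x)"
      by (intro has_derivative_diff dv u_has_derivative)
    then show ?thesis using V\<sigma>[OF x] \<sigma>\<tau>[OF x] by (simp add: has_derivative_at_withinI)
  qed
  then obtain c where c: "\<And>x. x \<in> ball 0 \<epsilon> \<Longrightarrow> v x - u x = c"
    using has_derivative_zero_constant[OF convex_ball[of 0 \<epsilon>], of "\<lambda>x. v x - u x"] by metis
  have "u 0 = 0"
  proof -
    have "\<tau> 0 = 0" using \<tau>_axis[of 0] r \<rho> by simp
    then show ?thesis by (simp add: u_def H_def)
  qed
  then have "c = 0" using c[of 0] \<epsilon> v0 by simp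
  then show ?thesis using c \<epsilon> by (intro exI[of _ \<epsilon>]) auto
qed

end

section \<open>Solutions for a curve on the sphere\<close>

definition unit_normal :: "'a::euclidean_space \<Rightarrow> 'a \<times> real" where
  "unit_normal p = (1 / norm (p, -1::real)) *\<^sub>R (p, -1)"

text \<open>Central projection of the lower hemisphere onto the hyperplane with last coordinate -1,
  the inverse of \<open>unit_normal\<close>.\<close>

definition slope :: "'a::euclidean_space \<times> real \<Rightarrow> 'a" where
  "slope q = (- 1 / snd q) *\<^sub>R fst q"

lemma norm_normal_pos: "0 < norm (p::'a::euclidean_space, -1::real)"
  by (simp add: zero_prod_def)

lemma slope_unit_normal: "slope (unit_normal p) = p"
  using norm_normal_pos[of p] by (simp add: slope_def unit_normal_def)

lemma unit_normal_slope:
  assumes "norm q = 1" "snd q < 0"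
  shows "unit_normal (slope q) = q"
proof -
  have eq: "(slope q, -1) = (- 1 / snd q) *\<^sub>R q"
    using assms(2) by (simp add: slope_def prod_eq_iff)
  have "norm ((- 1 / snd q) *\<^sub>R q) = - 1 / snd q"
    using assms by simp
  then show ?thesis unfolding unit_normal_def eq using assms(2) by simp
qed

text \<open>The last component of the derivative isolates \<open>c' h\<close>; once it is 0, the
  other components force \<open>h = 0\<close>. Thus \<open>unit_normal\<close> is an immersion and
  composing with it preserves rank.\<close>

lemma unit_normal_has_derivative:
  fixes p :: "'a::euclidean_space"
  obtains N' where "(unit_normal has_derivative N') (at p)" "\<And>h. N' h = 0 \<Longrightarrow> h = 0"
proof -
  have emb: "((\<lambda>p. (p, -1::real)) has_derivative (\<lambda>h. (h, 0))) (at p)"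
    by (intro has_derivative_Pair has_derivative_ident has_derivative_const)
  have "(\<lambda>p::'a. norm (p, -1::real)) differentiable (at p)"
    using differentiable_compose[of norm "\<lambda>p::'a. (p, -1::real)" p UNIV] emb norm_normal_pos[of p]
    by (auto simp: differentiable_def intro!: differentiable_norm_at[unfolded differentiable_def])
  then have "(\<lambda>p::'a. 1 / norm (p, -1::real)) differentiable (at p)"
    using norm_normal_pos[of p] by (intro differentiable_divide) auto
  then obtain c' where c': "((\<lambda>p::'a. 1 / norm (p, -1::real)) has_derivative c') (at p)"
    by (auto simp: differentiable_def)
  show ?thesis
  proof
    show "(unit_normal has_derivative (\<lambda>h. (1 / norm (p, -1::real)) *\<^sub>R (h, 0) + c' h *\<^sub>R (p, -1))) (at p)"
      unfolding unit_normal_def[abs_def] by (rule has_derivative_scaleR[OF c' emb])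
    fix h assume *: "(1 / norm (p, -1::real)) *\<^sub>R (h, 0) + c' h *\<^sub>R (p, -1::real) = 0"
    have "c' h = 0" using arg_cong[OF *, of snd] by simp
    then show "h = 0" using arg_cong[OF *, of fst] norm_normal_pos[of p] by simp
  qed
qed

section \<open>The Gauss map through the gradient, and its rank\<close>

lemma gauss_map_eq: "gauss_map u q = unit_normal (grad u (fst q))"
  by (simp add: gauss_map_def unit_normal_def)

lemma grad_eq:
  assumes "(u has_derivative (\<lambda>h. p \<bullet> h)) (at x)" shows "grad u x = p"
  by (simp add: grad_def vec_eq_iff inner_axis frechet_derivative_at[OF assms, symmetric])

lemma dim_range_rank_one:
  fixes d :: "'a::real_vector \<Rightarrow> real" and w :: "'b::euclidean_space"
  assumes "linear d" "d h \<noteq> 0" "w \<noteq> 0"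
  shows "dim (range (\<lambda>h. d h *\<^sub>R w)) = 1"
proof -
  have "range (\<lambda>h. d h *\<^sub>R w) = span {w}"
  proof (intro equalityI subsetI)
    fix z assume "z \<in> span {w}"
    then obtain c where "z = c *\<^sub>R w" by (auto simp: span_singleton)
    moreover have "d ((c / d h) *\<^sub>R h) = c" using assms by (simp add: linear_scale)
    ultimately show "z \<in> range (\<lambda>h. d h *\<^sub>R w)" by (metis rangeI)
  qed (auto simp: span_singleton)
  then show ?thesis using assms(3) by simp
qed

text \<open>The range of \<open>D\<close> is the line through the nonzero vector \<open>D e\<close>.
  Injectivity of the derivative of \<open>unit_normal\<close> makes \<open>V' h\<close> a multiple
  of \<open>V' e\<close>, and the \<open>b\<close>-component shows that the multiple is 0.\<close>

lemma rank_one_kernel: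
  fixes V :: "'a::euclidean_space \<Rightarrow> 'b::euclidean_space"
  assumes D: "((\<lambda>y. unit_normal (V y)) has_derivative D) (at x)" "dim (range D) = 1"
    and V: "(V has_derivative V') (at x)" and e: "V' e \<bullet> b \<noteq> 0" and h: "V' h \<bullet> b = 0"
  shows "V' h = 0"
proof -
  obtain N' where N': "(unit_normal has_derivative N') (at (V x))" "\<And>h. N' h = 0 \<Longrightarrow> h = 0"
    by (rule unit_normal_has_derivative[of "V x"]) blast
  have "((\<lambda>y. unit_normal (V y)) has_derivative (\<lambda>h. N' (V' h))) (at x)"
    by (rule has_derivative_compose[OF V N'(1)])
  then have D_eq: "D = (\<lambda>h. N' (V' h))" using D(1) has_derivative_unique by blast
  have lin: "linear D" "linear N'" "linear V'"
    using D(1) N'(1) V has_derivative_linear by auto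
  have "D e \<noteq> 0" using e N'(2)[of "V' e"] by (auto simp: D_eq)
  then have "dim (span {D e}) = 1" by simp
  moreover have "span {D e} \<subseteq> range D"
    using lin(1) by (intro span_minimal) (auto intro: linear_subspace_image)
  ultimately have "span {D e} = range D"
    using D(2) lin(1) by (intro subspace_dim_equal) (auto intro: linear_subspace_image)
  then obtain c where "D h = c *\<^sub>R D e" by (metis rangeI span_singleton imageE)
  then have "N' (V' h - c *\<^sub>R V' e) = 0"
    using lin(2) by (simp add: D_eq linear_diff linear_scale)
  then have *: "V' h = c *\<^sub>R V' e" using N'(2) by fastforce
  then have "c = 0" using e h by auto
  then show ?thesis using * by simp
qed

text \<open>The slope is a quotient of components of \<open>\<gamma>\<close>, and the extended
  denominator is -1 at 0. The quotient rule with \<open>\<gamma> 0 = (0, -1)\<close> and velocity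
  \<open>(e, 0)\<close> gives slope component \<open>e\<close> the derivative 1 at 0.\<close>

lemma slope_holomorphic_extension:
  fixes \<gamma> :: "real \<Rightarrow> 'a::euclidean_space \<times> real"
  assumes "real_analytic_on \<gamma> {-1<..<1}" "\<gamma> ` {-1<..<1} \<subseteq> sphere 0 1" "\<gamma> 0 = (0, -1)"
    and "(\<gamma> has_vector_derivative (e, 0)) (at 0)" and e: "e \<in> Basis"
  obtains R G where "0 < R" "\<And>b. b \<in> Basis \<Longrightarrow> G b holomorphic_on ball 0 R"
    "\<And>b t. b \<in> Basis \<Longrightarrow> \<bar>t\<bar> < R \<Longrightarrow> G b (of_real t) = of_real (slope (\<gamma> t) \<bullet> b)"
    "deriv (G e) 0 \<noteq> 0" "\<And>t. \<bar>t\<bar> < R \<Longrightarrow> unit_normal (slope (\<gamma> t)) = \<gamma> t"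
proof -
  define g where "g t = slope (\<gamma> t)" for t
  have ee: "e \<bullet> e = 1" using e by simp
  have cont: "isCont \<gamma> 0" using assms(4) by (rule has_vector_derivative_continuous)
  have "isCont (\<lambda>t. snd (\<gamma> t)) 0" using cont by (intro continuous_intros)
  moreover have "snd (\<gamma> 0) < 0" using assms(3) by simp
  ultimately have "\<forall>\<^sub>F t in at 0. snd (\<gamma> t) < 0"
    unfolding isCont_def by (rule order_tendstoD)
  then obtain \<delta> where \<delta>: "\<delta> > 0" "\<And>t. t \<noteq> 0 \<Longrightarrow> dist t 0 < \<delta> \<Longrightarrow> snd (\<gamma> t) < 0"
    unfolding eventually_at by auto
  have neg: "snd (\<gamma> t) < 0" if "\<bar>t\<bar> < \<delta>" for t
    using \<delta>(2)[of t] that \<open>snd (\<gamma> 0) < 0\<close> by (cases "t = 0") auto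
  have unit: "unit_normal (g t) = \<gamma> t" if "\<bar>t\<bar> < \<delta>" "\<bar>t\<bar> < 1" for t
  proof -
    have "\<gamma> t \<in> sphere 0 1" by (rule subsetD[OF assms(2) imageI]) (use that(2) in auto)
    then show ?thesis unfolding g_def using neg[OF that(1)] by (intro unit_normal_slope) auto
  qed

  have Basis_pair: "(b, 0) \<in> (Basis :: ('a \<times> real) set)" "(0, 1) \<in> (Basis :: ('a \<times> real) set)" if "b \<in> Basis" for b :: "'a"
    using that by (auto simp: Basis_prod_def)
  obtain rq Q where rq: "rq > 0" and Q: "Q holomorphic_on ball 0 rq"
    and Q_real: "\<And>t. \<bar>t\<bar> < rq \<Longrightarrow> Q (of_real t) = of_real (snd (\<gamma> t))"
  proof -
    have "\<exists>r>0. \<exists>F. F holomorphic_on ball 0 r \<and> (\<forall>t. \<bar>t\<bar> < r \<longrightarrow> F (of_real t) = of_real (\<gamma> t \<bullet> (0, 1)))"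
      by (rule real_analytic_holomorphic_extension[OF assms(1) _ Basis_pair(2)[OF e]]) auto
    then obtain r F where "r > 0" "F holomorphic_on ball 0 r"
      "\<forall>t. \<bar>t\<bar> < r \<longrightarrow> F (of_real t) = of_real (\<gamma> t \<bullet> (0, 1))" by blast
    then show ?thesis using that[of r F] by (auto simp: inner_prod_def)
  qed
  have "\<forall>b\<in>Basis. \<exists>r F. r > 0 \<and> F holomorphic_on ball 0 r \<and> (\<forall>t. \<bar>t\<bar> < r \<longrightarrow> F (of_real t) = of_real (fst (\<gamma> t) \<bullet> b))"
  proof
    fix b :: "'a" assume b: "b \<in> Basis"
    have "\<exists>r>0. \<exists>F. F holomorphic_on ball 0 r \<and> (\<forall>t. \<bar>t\<bar> < r \<longrightarrow> F (of_real t) = of_real (\<gamma> t \<bullet> (b, 0)))"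
      by (rule real_analytic_holomorphic_extension[OF assms(1) _ Basis_pair(1)[OF b]]) auto
    then show "\<exists>r F. r > 0 \<and> F holomorphic_on ball 0 r \<and> (\<forall>t. \<bar>t\<bar> < r \<longrightarrow> F (of_real t) = of_real (fst (\<gamma> t) \<bullet> b))"
      by (auto simp: inner_prod_def)
  qed
  then obtain rp P where rp: "\<forall>b\<in>Basis. rp b > 0 \<and> P b holomorphic_on ball 0 (rp b) \<and>
      (\<forall>t. \<bar>t\<bar> < rp b \<longrightarrow> P b (of_real t) = of_real (fst (\<gamma> t) \<bullet> b))"
    unfolding bchoice_iff by blast
  have "continuous_on (ball 0 rq) Q" using Q by (rule holomorphic_on_imp_continuous_on)
  moreover have "Q 0 \<noteq> 0" using Q_real[of 0] rq assms(3) by simp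
  ultimately obtain rn where rn: "rn > 0" "\<And>w. dist 0 w < rn \<Longrightarrow> Q w \<noteq> 0"
    using continuous_on_open_avoid[of "ball 0 rq" Q 0 0] rq by auto
  \<comment> \<open>One radius on which all extensions exist, \<open>Q\<close> has no zero, the last
    coordinate of \<open>\<gamma>\<close> is negative and the parameter stays in the domain.\<close>
  define R where "R = Min ({rq, rn, \<delta>, 1} \<union> rp ` Basis)"
  have R_le: "R \<le> x" if "x \<in> {rq, rn, \<delta>, 1} \<union> rp ` Basis" for x
    unfolding R_def by (rule Min_le[OF _ that]) simp
  have "R > 0" unfolding R_def using rq rn(1) \<delta>(1) rp by (subst Min_gr_iff) auto
  then have R: "R > 0" "R \<le> rq" "R \<le> rn" "R \<le> \<delta>" "R \<le> 1" "\<And>b. b \<in> Basis \<Longrightarrow> R \<le> rp b"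
    by (auto intro: R_le)
  define G where "G b w = - P b w / Q w" for b w
  have G_holo: "G b holomorphic_on ball 0 R" if "b \<in> Basis" for b
  proof -
    have "P b holomorphic_on ball 0 R"
      using rp that R(6)[OF that] by (auto intro: holomorphic_on_subset)
    moreover have "Q holomorphic_on ball 0 R"
      using R by (intro holomorphic_on_subset[OF Q]) auto
    ultimately show ?thesis
      unfolding G_def[abs_def] using rn(2) R by (intro holomorphic_intros) auto
  qed
  have G_real: "G b (of_real t) = of_real (g t \<bullet> b)" if "b \<in> Basis" "\<bar>t\<bar> < R" for b t
  proof -
    have "P b (of_real t) = of_real (fst (\<gamma> t) \<bullet> b)"
      using rp that R(6)[OF that(1)] by (meson order_less_le_trans)
    then show ?thesis using Q_real[of t] that(2) R(2) by (simp add: G_def g_def slope_def)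
  qed
  have deriv_nz: "deriv (G e) 0 \<noteq> 0"
  proof
    assume 0: "deriv (G e) 0 = 0"
    have "(G e has_field_derivative deriv (G e) 0) (at (of_real 0))"
      using holomorphic_derivI[OF G_holo[OF e] open_ball, of 0] R(1) by simp
    then have "((\<lambda>t. G e (of_real t)) has_vector_derivative 0) (at 0)"
      unfolding 0 by (rule has_vector_derivative_real_field)
    from bounded_linear.has_vector_derivative[OF bounded_linear_Re this]
    have "((\<lambda>t. Re (G e (of_real t))) has_real_derivative 0) (at 0)"
      by (simp add: has_real_derivative_iff_has_vector_derivative)
    then have 1: "((\<lambda>t. g t \<bullet> e) has_real_derivative 0) (at 0)"
      by (rule has_field_derivative_transform_within_open[of _ _ _ "ball 0 R"]) (use R G_real[OF e] in auto)
    have "((\<lambda>t. fst (\<gamma> t) \<bullet> e) has_vector_derivative e \<bullet> e) (at 0)"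
      using bounded_linear.has_vector_derivative[OF bounded_linear_compose[OF bounded_linear_inner_left bounded_linear_fst] assms(4)]
      by simp
    moreover have "((\<lambda>t. snd (\<gamma> t)) has_vector_derivative 0) (at 0)"
      using bounded_linear.has_vector_derivative[OF bounded_linear_snd assms(4)] by simp
    ultimately have "((\<lambda>t. - (fst (\<gamma> t) \<bullet> e) / snd (\<gamma> t)) has_real_derivative 1) (at 0)"
      unfolding has_real_derivative_iff_has_vector_derivative[symmetric]
      using assms(3) ee by (auto intro!: derivative_eq_intros)
    then have "((\<lambda>t. g t \<bullet> e) has_real_derivative 1) (at 0)"
      by (simp add: g_def slope_def)
    then show False using 1 DERIV_unique by fastforce
  qed
  show ?thesis
  proof (rule that[of R G])
    show "0 < R" "deriv (G e) 0 \<noteq> 0" by (fact R(1) deriv_nz)+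
    show "G b holomorphic_on ball 0 R" if "b \<in> Basis" for b by (rule G_holo[OF that])
    show "G b (of_real t) = of_real (slope (\<gamma> t) \<bullet> b)" if "b \<in> Basis" "\<bar>t\<bar> < R" for b t
      using G_real[OF that] by (simp add: g_def)
    show "unit_normal (slope (\<gamma> t)) = \<gamma> t" if "\<bar>t\<bar> < R" for t
      using unit[of t] that R by (simp add: g_def)
  qed
qed

text \<open>The normal is \<open>unit_normal\<close> of \<open>g\<close> at \<open>\<tau> x\<close>,
  so its derivative is the derivative of \<open>\<tau>\<close> times one vector. Neither factor
  vanishes: the former is positive at \<open>e\<close>, and the latter is the image of
  \<open>g'\<close> under an injective map.\<close>

lemma gauss_curve_is_solution:
  fixes \<gamma> :: "real \<Rightarrow> (real^'n) \<times> real"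
  assumes "gauss_curve (axis k 1) g G R \<rho> M r" "r \<le> \<rho>"
    and unit: "\<And>t. \<bar>t\<bar> < R \<Longrightarrow> unit_normal (g t) = \<gamma> t"
  shows "is_solution \<gamma> k (gauss_curve.u (axis k 1) g G \<rho>) r"
proof -
  define e :: "real^'n" where "e = axis k 1"
  interpret S: gauss_curve e g G R \<rho> M r using assms(1) by (simp add: e_def)
  note e = S.e_Basis
  have grad_u: "grad S.u x = g (S.\<tau> x)" if "norm x < r" for x
    by (rule grad_eq[OF S.u_has_derivative[OF that]])
  have "is_solution \<gamma> k S.u r"
    unfolding is_solution_def
  proof (intro conjI ballI allI impI)
    show "0 < r" by (rule S.r)
    show "real_analytic_on S.u (ball 0 r)" by (rule S.u_analytic)
    have "S.\<tau> 0 = 0" using S.\<tau>_axis[of 0] S.r S.\<rho> by simp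
    then show "S.u 0 = 0" by (simp add: S.u_def S.H_def)
    show "gauss_rank_eq S.u x 1" if "x \<in> ball 0 r" for x
    proof -
      have x: "norm x < r" "norm x \<le> r" using that by auto
      define d where "d h = S.\<beta> h (S.\<tau> x) / (1 - S.\<beta>' x (S.\<tau> x))" for h
      obtain N' where N': "(unit_normal has_derivative N') (at (g (S.\<tau> x)))" "\<And>h. N' h = 0 \<Longrightarrow> h = 0"
        by (rule unit_normal_has_derivative[of "g (S.\<tau> x)"]) blast
      have "((\<lambda>y. unit_normal (g (S.\<tau> y))) has_derivative (\<lambda>h. N' (d h *\<^sub>R S.g' (S.\<tau> x)))) (at x)"
        unfolding d_def by (rule has_derivative_compose[OF S.g_\<tau>_has_derivative[OF x(1)] N'(1)])
      moreover have "N' (d h *\<^sub>R S.g' (S.\<tau> x)) = d h *\<^sub>R N' (S.g' (S.\<tau> x))" for h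
        using has_derivative_linear[OF N'(1)] by (simp add: linear_scale)
      ultimately have "((\<lambda>y. unit_normal (g (S.\<tau> y))) has_derivative (\<lambda>h. d h *\<^sub>R N' (S.g' (S.\<tau> x)))) (at x)"
        by simp
      then have "((\<lambda>y. gauss_map S.u (y, S.u y)) has_derivative (\<lambda>h. d h *\<^sub>R N' (S.g' (S.\<tau> x)))) (at x)"
        by (rule has_derivative_transform_within_open[OF _ open_ball that]) (simp add: gauss_map_eq grad_u)
      moreover have "dim (range (\<lambda>h. d h *\<^sub>R N' (S.g' (S.\<tau> x)))) = 1"
      proof (rule dim_range_rank_one)
        show "linear d"
          unfolding d_def[abs_def] by (rule has_derivative_linear[OF S.\<tau>_has_derivative[OF x(1)]])
        have "S.\<beta> e (S.\<tau> x) = 1"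
          unfolding S.\<beta>_def using S.\<phi>_e[of "of_real (S.\<tau> x)"] S.\<tau>_less(2)[OF x(2)] by simp
        then show "d e \<noteq> 0" using S.one_minus_\<beta>'_pos[OF x(2)] by (simp add: d_def)
        show "N' (S.g' (S.\<tau> x)) \<noteq> 0"
          using N'(2)[of "S.g' (S.\<tau> x)"] S.g'_e_nz[OF S.\<tau>_less(2)[OF x(2)]] by auto
      qed
      ultimately show ?thesis unfolding gauss_rank_eq_def by blast
    qed
    show "gauss_map S.u (t *\<^sub>R axis k 1, S.u (t *\<^sub>R axis k 1)) = \<gamma> t" if "\<bar>t\<bar> < r \<and> \<bar>t\<bar> < 1" for t
    proof -
      have "S.\<tau> (t *\<^sub>R e) = t" using that assms(2) by (intro S.\<tau>_axis) auto
      moreover have "norm (t *\<^sub>R e) < r" using that e by simp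
      ultimately show ?thesis
        using that assms(2) unit[of t] S.\<rho> by (simp add: gauss_map_eq grad_u flip: e_def)
    qed
  qed
  then show ?thesis by (simp add: e_def)
qed

text \<open>Applying \<open>slope\<close> to the prescribed normals recovers the gradient of
  \<open>v\<close> on the axis; on a small enough ball the hypotheses of \<open>u_unique\<close>
  then hold.\<close>

lemma gauss_curve_solution_unique:
  fixes \<gamma> :: "real \<Rightarrow> (real^'n) \<times> real"
  assumes "gauss_curve (axis k 1) (\<lambda>t. slope (\<gamma> t)) G R \<rho> M r" and sol: "is_solution \<gamma> k v s"
  shows "\<exists>\<epsilon>>0. \<forall>x\<in>ball 0 \<epsilon>. v x = gauss_curve.u (axis k 1) (\<lambda>t. slope (\<gamma> t)) G \<rho> x"
proof -
  define e :: "real^'n" where "e = axis k 1"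
  define g where "g = (\<lambda>t. slope (\<gamma> t))"
  interpret S: gauss_curve e g G R \<rho> M r using assms(1) by (simp add: e_def g_def)
  note e = S.e_Basis
  have s: "s > 0" and v_an: "real_analytic_on v (ball 0 s)" and v0: "v 0 = 0"
    and rank: "\<And>x. x \<in> ball 0 s \<Longrightarrow> gauss_rank_eq v x 1"
    and curve: "\<And>t. \<bar>t\<bar> < s \<Longrightarrow> \<bar>t\<bar> < 1 \<Longrightarrow> gauss_map v (t *\<^sub>R e, v (t *\<^sub>R e)) = \<gamma> t"
    using sol unfolding is_solution_def e_def by auto
  obtain s1 V V' where s1: "0 < s1"
    and dv: "\<And>x. x \<in> ball 0 s1 \<Longrightarrow> (v has_derivative (\<lambda>h. V x \<bullet> h)) (at x)"
    and dV: "\<And>x. x \<in> ball 0 s1 \<Longrightarrow> (V has_derivative V' x) (at x)"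
    and exD: "\<And>e. e \<in> Basis \<Longrightarrow> \<exists>D. continuous_on (ball 0 s1) D \<and> (\<forall>x\<in>ball 0 s1. \<forall>h. V' x h \<bullet> e = h \<bullet> D x)"
    using real_analytic_C2[OF v_an] s by (metis centre_in_ball)
  obtain D where D: "continuous_on (ball 0 s1) D" "\<And>x h. x \<in> ball 0 s1 \<Longrightarrow> V' x h \<bullet> e = h \<bullet> D x"
    using exD[OF e] by blast
  have grad_v: "grad v x = V x" if "x \<in> ball 0 s1" for x by (rule grad_eq[OF dv[OF that]])
  have axis: "V (t *\<^sub>R e) = g t" if "\<bar>t\<bar> < s1" "\<bar>t\<bar> < s" "\<bar>t\<bar> < 1" for t
  proof -
    have "t *\<^sub>R e \<in> ball 0 s1" using that e by simp
    then have "unit_normal (V (t *\<^sub>R e)) = \<gamma> t"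
      using curve[OF that(2,3)] by (simp add: gauss_map_eq grad_v)
    then show ?thesis using slope_unit_normal[of "V (t *\<^sub>R e)"] by (simp add: g_def)
  qed
  \<comment> \<open>Along the axis \<open>V\<close> coincides with \<open>g\<close>, so this number
    is the \<open>e\<close>-component of \<open>g' 0\<close>.\<close>
  have "D 0 \<bullet> e \<noteq> 0"
  proof -
    have V0: "((\<lambda>t. V (t *\<^sub>R e)) has_derivative (\<lambda>h. V' (0 *\<^sub>R e) (h *\<^sub>R e))) (at 0)"
      by (rule has_derivative_compose[where f = "\<lambda>t. t *\<^sub>R e"])
         (use dV s1 in \<open>auto intro!: derivative_eq_intros\<close>)
    have "(g has_derivative (\<lambda>h. V' (0 *\<^sub>R e) (h *\<^sub>R e))) (at 0)"
      by (rule has_derivative_transform_within_open[OF V0 open_ball[of 0 "min s1 (min s 1)"]])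
         (use axis s s1 in auto)
    then have "(\<lambda>h. V' (0 *\<^sub>R e) (h *\<^sub>R e)) = (\<lambda>h. h *\<^sub>R S.g' 0)"
      using S.g_has_vector_derivative[of 0] S.\<rho> unfolding has_vector_derivative_def
      by (intro has_derivative_unique) auto
    then have "V' (0 *\<^sub>R e) (1 *\<^sub>R e) = 1 *\<^sub>R S.g' 0" by meson
    then have "e \<bullet> D 0 = S.g' 0 \<bullet> e" using D(2)[of 0 e] s1 by simp
    then show ?thesis using S.g'_e_nz[of 0] S.\<rho> by (simp add: inner_commute)
  qed
  moreover have "continuous_on (ball 0 s1) (\<lambda>x. D x \<bullet> e)" by (intro continuous_intros D(1))
  ultimately obtain s2 where s2: "s2 > 0" "\<And>x. dist 0 x < s2 \<Longrightarrow> D x \<bullet> e \<noteq> 0"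
    using continuous_on_open_avoid[of "ball 0 s1" "\<lambda>x. D x \<bullet> e" 0 0] s1 by auto
  define s3 where "s3 = Min {s, s1, s2, 1}"
  have s3: "0 < s3" "s3 \<le> s" "s3 \<le> s1" "s3 \<le> s2" "s3 \<le> 1"
    using s s1 s2 by (auto simp: s3_def)
  have V'e: "V' x e \<bullet> e \<noteq> 0" if "x \<in> ball 0 s3" for x
    using D(2)[of x e] s2(2)[of x] that s3 by (auto simp: inner_commute)
  have "\<exists>\<epsilon>>0. \<forall>x\<in>ball 0 \<epsilon>. v x = S.u x"
  proof (rule S.u_unique[of s3 v V V' D])
    fix x :: "real^'n" assume x: "x \<in> ball 0 s3"
    then have x1: "x \<in> ball 0 s1" and xs: "x \<in> ball 0 s" using s3 by auto
    show "(v has_derivative (\<lambda>h. V x \<bullet> h)) (at x)" by (rule dv[OF x1])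
    show "(V has_derivative V' x) (at x)" by (rule dV[OF x1])
    show "V' x h \<bullet> e = h \<bullet> D x" for h by (rule D(2)[OF x1])
    show "D x \<bullet> e \<noteq> 0" using s2(2) x s3 by auto
    obtain D' where D': "((\<lambda>y. gauss_map v (y, v y)) has_derivative D') (at x)" "dim (range D') = 1"
      using rank[OF xs] unfolding gauss_rank_eq_def by blast
    from D'(1) have "((\<lambda>y. unit_normal (V y)) has_derivative D') (at x)"
      by (rule has_derivative_transform_within_open[OF _ open_ball x1]) (simp add: gauss_map_eq grad_v)
    then show "V' x h = 0" if "h \<bullet> D x = 0" for h
      using rank_one_kernel[OF _ D'(2) dV[OF x1] V'e[OF x]] D(2)[OF x1] that by simp
  next
    show "0 < s3" "v 0 = 0" by (fact s3(1) v0)+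
    show "continuous_on (ball 0 s3) D"
      using s3 by (intro continuous_on_subset[OF D(1)]) auto
    show "V (t *\<^sub>R e) = g t" if "\<bar>t\<bar> < s3" for t
      using that s3 by (intro axis) auto
  qed
  then show ?thesis by (simp add: e_def g_def)
qed

theorem theorem1p6:
  fixes \<gamma> :: "real \<Rightarrow> (real^'n) \<times> real" and k :: 'n
  assumes "real_analytic_on \<gamma> {-1<..<1}"
    and "\<gamma> ` {-1<..<1} \<subseteq> sphere 0 1"
    and "\<gamma> 0 = (0, -1)"
    and "(\<gamma> has_vector_derivative (axis k 1, 0)) (at 0)"
  shows "\<exists>u r. is_solution \<gamma> k u r \<and>
           (\<forall>v s. is_solution \<gamma> k v s \<longrightarrow> (\<exists>e>0. \<forall>x\<in>ball 0 e. v x = u x))"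
proof -
  obtain R G where R: "0 < R" and G: "\<And>b. b \<in> Basis \<Longrightarrow> G b holomorphic_on ball 0 R"
    "\<And>b t. b \<in> Basis \<Longrightarrow> \<bar>t\<bar> < R \<Longrightarrow> G b (of_real t) = of_real (slope (\<gamma> t) \<bullet> b)"
    "deriv (G (axis k 1)) 0 \<noteq> 0" and unit: "\<And>t. \<bar>t\<bar> < R \<Longrightarrow> unit_normal (slope (\<gamma> t)) = \<gamma> t"
    by (rule slope_holomorphic_extension[OF assms]) auto
  obtain R' \<rho> M r where gc: "gauss_curve (axis k 1) (\<lambda>t. slope (\<gamma> t)) G R' \<rho> M r"
    and R': "R' \<le> R" "r \<le> \<rho>"
    using gauss_curve_exists[OF _ R G] by (metis axis_in_Basis_iff Basis_real_def insertI1)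
  have "is_solution \<gamma> k (gauss_curve.u (axis k 1) (\<lambda>t. slope (\<gamma> t)) G \<rho>) r"
    using unit R' by (intro gauss_curve_is_solution[OF gc]) auto
  then show ?thesis using gauss_curve_solution_unique[OF gc] by blast
qed

end
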